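(* Let $0\le b\le a<\infty$ with $a>0$, and let $\xi(a,b)=\lambda(a,b)\frac{a+b}{2}$ be the parking constant (asymptotic coverage density) of the trapezium parking model with parameters $a,b$. Then $$\xi(a,b)=\frac{1+\frac ba}{4}\int_0^\infty\left(2+e^{-t\frac ba}-e^{-t}\right)\exp\left(\int_0^t\left(-2+e^{-s(1+\frac ba)/2}+e^{-s}\right)\frac{ds}{s}\right)dt=\xi\left(1,\tfrac ba\right).$$
   Context: Fix reals $0\le b\le a<\infty$ with $a>0$. "Trapezium" means isosceles trapezium (degenerating to a triangle if $b=0$ and a rectangle if $a=b$). Strips. $\mathcal{T}_x$ is the trapezium of height $1$ with lower base of length $x+(a-b)/2$ and upper base of length $x-(a-b)/2$. $\mathcal{P}_x$ is the parallelogram of height $1$ with two horizontal parallel sides of length $x$ and acute angle $\arctan(2/(a-b))$ (and $\pi/2$ if $a=b$), whose left-most point is on the upper line. Both have area $x$. The deposited particle is a copy of $\mathcal{T}_{(a+b)/2}$ (bases $a$ and $b$, height $1$), placed with its longer base on the upper line ("up") or on the lower line ("down") of the strip; its position is given by the distance from the left end of that line to the left endpoint of the longer base. Uniform depositing algorithm (UDA). On $\mathcal{P}_x$ with $x>a$: draw $\tau\sim\mathcal{U}(0,2x-2a)$. If $\tau\in(0,x-a)$, deposit up at position $\tau$; the remaining region consists of two strips $\mathcal{P}_\tau$ and $\mathcal{T}_{x-\tau-(a+b)/2}$. If $\tau\in[x-a,2x-2a)$, deposit down at position $y=\tau+a-x$; the remaining strips are $\mathcal{T}_{t}$ and $\mathcal{P}_{x-t-(a+b)/2}$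 with $t=y+(a-b)/2$. On $\mathcal{T}_x$ with $(a+b)/2<x<(3a-b)/2$: draw $\tau\sim\mathcal{U}(0,x-(a+b)/2)$ and deposit down at position $\tau$; the remaining strips are $\mathcal{P}_\tau$ and $\mathcal{P}_{x-\tau-(a+b)/2}$. On $\mathcal{T}_x$ with $x\ge(3a-b)/2$ (and $x>(a+b)/2$): draw $\tau\sim\mathcal{U}(0,2x-2a)$. If $\tau\in(0,x-(3a-b)/2)$, deposit up at position $\tau$; the remaining strips are $\mathcal{T}_{\tau+(a-b)/2}$ and $\mathcal{T}_{x-\tau-a}$. If $\tau\in[x-(3a-b)/2,2x-2a)$, deposit down at position $y=\tau-(x-(3a-b)/2)$; the remaining strips are $\mathcal{P}_y$ and $\mathcal{P}_{x-y-(a+b)/2}$. (Strips are identified up to reflection.) Conditionally on the first deposition, the procedure continues on the two remaining strips with independent copies of the UDA, recursively, until no remaining strip can fit $\mathcal{T}_{(a+b)/2}$. $P_x$ (resp. $T_x$) is the total number of particles deposited on $\mathcal{P}_x$ (resp. $\mathcal{T}_x$). Conventions: $P_x=0$ for $x\in[0,a)$, $P_a=1$, $T_x=0$ for $x\in[0,(a+b)/2)$, $T_{(a+b)/2}=1$. Set $\eta(x)=\tfrac12(\mathbb{E}[P_x]+\mathbb{E}[T_x])$, $\lambda(a,b)=\lim_{x\to\infty}\eta(x)/x$ (this limit exists in $(0,\infty)$), and $\xi(a,b)=\lambda(a,b)(a+b)/2$. *)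

theory Defs
  imports "HOL-Probability.Probability"
begin

text \<open>Strips of height 1, up to reflection, are determined by their shape and their area.\<close>

datatype strip = Parallelogram real | Trapezium real

text \<open>
  The law of the number of particles on a strip once one particle has been deposited on it and
  the two remaining strips, whose particle numbers have laws \<open>M\<close> and \<open>N\<close>, are filled independently.
\<close>

definition deposit_and_fill :: "nat measure \<Rightarrow> nat measure \<Rightarrow> nat measure" where
  "deposit_and_fill M N =
     bind M (\<lambda>k. bind N (\<lambda>l. return (count_space UNIV) (1 + k + l)))"

locale trapezium_parking =
  fixes a b :: real
  assumes b_nonneg: "0 \<le> b" and b_le_a: "b \<le> a" and a_pos: "0 < a"
begin

text \<open>
  \<open>particles S\<close> is the law of the total number of particles that the uniform depositing algorithm
  deposits on the strip \<open>S\<close>. In each branch the variable \<open>\<tau>\<close> is the uniform draw; the conditions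
  on \<open>\<tau>\<close> decide between depositing up and depositing down. The final
  \<open>return (count_space UNIV) 0\<close> of each branch is never reached, since \<open>\<tau>\<close> lies almost surely in
  the interval on which it is uniform; it only makes the recursion well-founded.
\<close>

function (sequential) particles :: "strip \<Rightarrow> nat measure" where
  "particles (Parallelogram x) =
    (if x < a then return (count_space UNIV) 0
     else if x = a then return (count_space UNIV) 1
     else bind (uniform_measure lborel {0<..<2 * x - 2 * a}) (\<lambda>\<tau>.
       if 0 < \<tau> \<and> \<tau> < x - a then \<comment> \<open>up, at position \<open>\<tau>\<close>\<close>
         deposit_and_fill (particles (Parallelogram \<tau>))
                          (particles (Trapezium (x - \<tau> - (a + b) / 2)))
       else if x - a \<le> \<tau> \<and> \<tau> < 2 * x - 2 * a then \<comment> \<open>down, at position \<open>\<tau> + a - x\<close>\<close>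
         deposit_and_fill (particles (Trapezium ((\<tau> + a - x) + (a - b) / 2)))
                          (particles (Parallelogram
                             (x - ((\<tau> + a - x) + (a - b) / 2) - (a + b) / 2)))
       else return (count_space UNIV) 0))"
| "particles (Trapezium x) =
    (if x < (a + b) / 2 then return (count_space UNIV) 0
     else if x = (a + b) / 2 then return (count_space UNIV) 1
     else if x < (3 * a - b) / 2 then
       bind (uniform_measure lborel {0<..<x - (a + b) / 2}) (\<lambda>\<tau>.
         if 0 < \<tau> \<and> \<tau> < x - (a + b) / 2 then \<comment> \<open>down, at position \<open>\<tau>\<close>\<close>
           deposit_and_fill (particles (Parallelogram \<tau>))
                            (particles (Parallelogram (x - \<tau> - (a + b) / 2)))
         else return (count_space UNIV) 0)
     else
       bind (uniform_measure lborel {0<..<2 * x - 2 * a}) (\<lambda>\<tau>.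
         if 0 < \<tau> \<and> \<tau> < x - (3 * a - b) / 2 then \<comment> \<open>up, at position \<open>\<tau>\<close>\<close>
           deposit_and_fill (particles (Trapezium (\<tau> + (a - b) / 2)))
                            (particles (Trapezium (x - \<tau> - a)))
         else if x - (3 * a - b) / 2 \<le> \<tau> \<and> \<tau> < 2 * x - 2 * a then
           \<comment> \<open>down, at position \<open>\<tau> - (x - (3 * a - b) / 2)\<close>\<close>
           deposit_and_fill (particles (Parallelogram (\<tau> - (x - (3 * a - b) / 2))))
                            (particles (Parallelogram
                               (x - (\<tau> - (x - (3 * a - b) / 2)) - (a + b) / 2)))
         else return (count_space UNIV) 0))"
  by pat_completeness auto

text \<open>Every deposition removes area \<open>(a + b) / 2\<close> from the strip.\<close>

termination
proof -
  let ?area = "\<lambda>S. case S of Parallelogram x \<Rightarrow> x | Trapezium x \<Rightarrow> x"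
  define c where "c = (a + b) / 2"
  have c: "0 < c" "c \<le> a" "b \<le> c"
    using b_nonneg b_le_a a_pos by (auto simp: c_def)
  have dec: "nat \<lfloor>y / c\<rfloor> < nat \<lfloor>x / c\<rfloor>" if "c \<le> x" "y \<le> x - c" for x y
  proof -
    have "y / c \<le> x / c - 1" and "1 \<le> x / c"
      using that c by (simp_all add: field_simps)
    then show ?thesis by linarith
  qed
  show ?thesis
    by (relation "Wellfounded.measure (\<lambda>S. nat \<lfloor>?area S / c\<rfloor>)")
      (rule wf_measure
        | (simp only: in_measure strip.case, rule dec; use c c_def in argo))+
qed

definition \<eta> :: "real \<Rightarrow> real" where
  "\<eta> x = ((\<integral>k. real k \<partial>particles (Parallelogram x)) + (\<integral>k. real k \<partial>particles (Trapezium x))) / 2"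

definition density :: real where
  "density = Lim at_top (\<lambda>x. \<eta> x / x)"

definition parking_constant :: real where
  "parking_constant = density * ((a + b) / 2)"

end

end

theory Submission
  imports Defs "HOL-Real_Asymp.Real_Asymp"
begin

text \<open>
  Write \<open>c = (a + b) / 2\<close>. Averaging over the position of the first particle gives integral equations
  for the expected numbers \<open>p x\<close> and \<open>t x\<close> of particles on the parallelogram and on the trapezium of
  area \<open>x\<close> (\<open>mean_Parallelogram_integral\<close>, \<open>mean_Trapezium_integral\<close>). The two equations are coupled,
  but their sum \<open>h = p + t\<close> satisfies a single delay equation: \<open>h\<close> vanishes below \<open>c\<close>, equals \<open>1\<close> on
  \<open>{c..<a}\<close>, and for \<open>x > a\<close>
  \[ (x - a) (h(x) - 2) = \int_0^{x-a} h + \int_0^{x-c} h . \]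
  This is \<open>expected_total_integral\<close>. To make sense of these expectations, the laws of the particle numbers
  must first be shown to depend measurably on the area (\<open>measurable_particles\<close>), because the
  monadic bind in their recursive definition has its usual properties only for measurable kernels.

  After scaling \<open>a\<close> to \<open>1\<close> and \<open>c\<close> to \<open>\<gamma> = c / a\<close>, the function \<open>f = h + 2\<close> solves the homogeneous equation
  \<open>((x - 1) f(x))' = f(x - 1) + f(x - \<gamma>)\<close>. Its adjoint \<open>(x - 1) y'(x) = - y(x + 1) - y(x + \<gamma>)\<close> is solved by
  the Laplace transform
  \[ y(x) = \int_0^\infty t E(t) e^{-(x-1)t} dt, \qquad
     E(t) = \exp \int_0^t (-2 + e^{-\gamma s} + e^{-s}) \frac{ds}{s} , \]
  so that
  \[ (x-1) f(x) y(x) + \int_{x-1}^x f(u) y(u+1) du + \int_{x-\gamma}^x f(u) y(u+\gamma) du \]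
  does not depend on \<open>x\<close> (\<open>conserved\<close>). As \<open>f\<close> grows at most linearly and \<open>y(x)\<close> is asymptotic to
  \<open>1 / x\<^sup>2\<close>, the two integrals vanish in the limit and the first term is asymptotic to \<open>f(x) / x\<close>. Hence
  \<open>f(x) / x\<close> converges to the conserved value; neither subadditivity nor a Tauberian theorem is needed.
  Near \<open>x = 1\<close> the conserved value is determined by the initial values of \<open>f\<close> alone, and
  \<open>conserved_value_eq\<close> turns it into the integral of the theorem, by means of the identity
  \<open>\<integral> (1 - e\<^sup>-\<^sup>t - e\<^sup>-\<^sup>\<gamma>\<^sup>t) E(t) dt = 0\<close>, whose integrand is the derivative of \<open>- t E(t)\<close>.
  The integral depends on \<open>b / a\<close> only, which gives the second equality.

  As \<open>f\<close>, \<open>y\<close> and \<open>E\<close> are nonnegative, nearly all integrals are taken in the extended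
  nonnegative reals, where Tonelli's theorem applies without integrability conditions.
\<close>

section \<open>Integrals of nonnegative functions over intervals\<close>

lemma nn_integral_interval_shift:
  fixes g :: "real \<Rightarrow> ennreal"
  assumes [measurable]: "g \<in> borel_measurable borel"
  shows "(\<integral>\<^sup>+\<tau>\<in>{p<..<q}. g (\<tau> - s) \<partial>lborel) = (\<integral>\<^sup>+u\<in>{p - s<..<q - s}. g u \<partial>lborel)"
  by (subst nn_integral_real_affine[where c=1 and t="- s" and f="\<lambda>u. g u * indicator {p - s<..<q - s} u"])
    (auto intro!: nn_integral_cong simp: indicator_def)

lemma nn_integral_interval_reflect:
  fixes g :: "real \<Rightarrow> ennreal"
  assumes [measurable]: "g \<in> borel_measurable borel"
  shows "(\<integral>\<^sup>+\<tau>\<in>{p<..<q}. g (s - \<tau>) \<partial>lborel) = (\<integral>\<^sup>+u\<in>{s - q<..<s - p}. g u \<partial>lborel)"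
  by (subst nn_integral_real_affine[where c="-1" and t=s and f="\<lambda>u. g u * indicator {s - q<..<s - p} u"])
    (auto intro!: nn_integral_cong simp: indicator_def)

lemma nn_integral_interval_split:
  fixes g :: "real \<Rightarrow> ennreal"
  assumes [measurable]: "g \<in> borel_measurable borel" and "p \<le> m" "m \<le> q"
  shows "(\<integral>\<^sup>+u\<in>{p<..<q}. g u \<partial>lborel)
       = (\<integral>\<^sup>+u\<in>{p<..<m}. g u \<partial>lborel) + (\<integral>\<^sup>+u\<in>{m<..<q}. g u \<partial>lborel)"
proof -
  have "(\<integral>\<^sup>+u\<in>{p<..<q}. g u \<partial>lborel)
      = (\<integral>\<^sup>+u. g u * indicator {p<..<m} u + g u * indicator {m<..<q} u \<partial>lborel)"
    using AE_lborel_singleton[of m] assms(2,3)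
    by (intro nn_integral_cong_AE, elim eventually_mono) (auto simp: indicator_def)
  then show ?thesis by (simp add: nn_integral_add)
qed

lemma nn_integral_interval_cong:
  assumes "\<And>u. p < u \<Longrightarrow> u < q \<Longrightarrow> f u = g u"
  shows "(\<integral>\<^sup>+u\<in>{p<..<q::real}. f u \<partial>lborel) = (\<integral>\<^sup>+u\<in>{p<..<q}. g u \<partial>lborel)"
  using assms by (intro nn_integral_cong) (auto simp: indicator_def)

lemma nn_integral_interval_add:
  fixes g :: "real \<Rightarrow> ennreal"
  assumes [measurable]: "f \<in> borel_measurable borel" "g \<in> borel_measurable borel"
  shows "(\<integral>\<^sup>+u\<in>{p<..<q}. f u + g u \<partial>lborel)
       = (\<integral>\<^sup>+u\<in>{p<..<q}. f u \<partial>lborel) + (\<integral>\<^sup>+u\<in>{p<..<q}. g u \<partial>lborel)"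
  by (simp add: distrib_right nn_integral_add)

lemma nn_integral_interval_const:
  "(\<integral>\<^sup>+u\<in>{p<..<q::real}. C \<partial>lborel) = C * ennreal (q - p)"
  by (cases "p \<le> q") (simp_all add: nn_integral_cmult_indicator ennreal_neg)

lemma ennreal_double_cancel: "2 * u = 2 * v \<Longrightarrow> u = v" for u v :: ennreal
  by (simp add: ennreal_mult_cancel_left)

text \<open>
  The up and the down branch of a draw are separated by a threshold \<open>m\<close>.
\<close>

lemma nn_integral_interval_two_branches:
  fixes f g :: "real \<Rightarrow> ennreal"
  assumes "f \<in> borel_measurable borel" "g \<in> borel_measurable borel" "0 \<le> m" "m \<le> q"
  shows "(\<integral>\<^sup>+u\<in>{0<..<q}. (if u < m then f u else g u) \<partial>lborel)
       = (\<integral>\<^sup>+u\<in>{0<..<m}. f u \<partial>lborel) + (\<integral>\<^sup>+u\<in>{m<..<q}. g u \<partial>lborel)"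
  using assms by (subst nn_integral_interval_split[of _ 0 m q])
    (auto intro!: arg_cong2[where f=plus] nn_integral_interval_cong)

lemma nn_integral_interval_closed:
  "(\<integral>\<^sup>+u\<in>{p<..<q::real}. f u \<partial>lborel) = (\<integral>\<^sup>+u\<in>{p..q}. f u \<partial>lborel)"
proof (rule nn_integral_cong_AE)
  show "AE u in lborel. f u * indicator {p<..<q} u = f u * indicator {p..q} u"
    using AE_lborel_singleton[of p] AE_lborel_singleton[of q]
    by eventually_elim (auto simp: indicator_def)
qed

text \<open>
  Each expected particle number is an average over the draw, so a bound that holds for every
  draw holds for it.
\<close>

lemma average_le:
  fixes m :: ennreal and l C :: real
  assumes "0 < l" "ennreal l * m = (\<integral>\<^sup>+\<tau>\<in>{0<..<l}. f \<tau> \<partial>lborel)"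
    and "\<And>\<tau>. 0 < \<tau> \<Longrightarrow> \<tau> < l \<Longrightarrow> f \<tau> \<le> ennreal C"
  shows "m \<le> ennreal C"
proof -
  have "ennreal l * m \<le> (\<integral>\<^sup>+\<tau>\<in>{0<..<l}. ennreal C \<partial>lborel)"
    unfolding assms(2) using assms(3) by (intro nn_integral_mono) (auto simp: indicator_def)
  also have "\<dots> = ennreal l * ennreal C"
    using assms(1) by (simp add: nn_integral_interval_const mult.commute)
  finally show ?thesis using assms(1) by (subst (asm) ennreal_mult_le_mult_iff) auto
qed

section \<open>Uniform draws and the law after one deposition\<close>

lemma uniform_measure_rescale:
  fixes l :: real
  assumes "0 < l"
  shows "uniform_measure lborel {0<..<l} = distr (uniform_measure lborel {0<..<1}) borel ((*) l)"
proof (rule measure_eqI)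
  fix A assume "A \<in> sets (uniform_measure lborel {0<..<l})"
  then have A[measurable]: "A \<in> sets borel" by simp
  have pre[measurable]: "(*) l -` A \<in> sets borel"
    using measurable_sets[of "(*) l" borel borel A] by simp
  have "emeasure lborel ({0<..<l} \<inter> A) = (\<integral>\<^sup>+x. indicator ({0<..<l} \<inter> A) x \<partial>lborel)"
    by simp
  also have "\<dots> = \<bar>l\<bar> * (\<integral>\<^sup>+x. indicator ({0<..<l} \<inter> A) (0 + l * x) \<partial>lborel)"
    by (rule nn_integral_real_affine) (use assms in auto)
  also have "(\<lambda>x. indicator ({0<..<l} \<inter> A) (0 + l * x) :: ennreal)
      = indicator ({0<..<1} \<inter> (*) l -` A)"
    using assms by (auto simp: fun_eq_iff indicator_def zero_less_mult_iff)
  finally show "emeasure (uniform_measure lborel {0<..<l}) A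
      = emeasure (distr (uniform_measure lborel {0<..<1}) borel ((*) l)) A"
    using assms by (simp add: emeasure_distr mult.commute[of "ennreal l"]
      ennreal_mult_divide_eq) (simp add: divide_ennreal_def)
qed simp

text \<open>
  Replacing the uniform draw on \<open>{0<..<l}\<close> by \<open>l\<close> times a uniform draw on \<open>{0<..<1}\<close> moves the dependence
  on \<open>l\<close> from the measure into the kernel, which makes measurability in \<open>l\<close> accessible.
\<close>

lemma bind_uniform_rescale:
  fixes l :: real
  assumes "0 < l" and "f \<in> borel \<rightarrow>\<^sub>M subprob_algebra N"
  shows "bind (uniform_measure lborel {0<..<l}) f
       = bind (uniform_measure lborel {0<..<1}) (\<lambda>u. f (l * u))"
  unfolding uniform_measure_rescale[OF assms(1)]
  by (rule bind_distr) (use assms in auto)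

lemma prob_space_uniform_lborel:
  fixes l :: real
  assumes "0 < l"
  shows "prob_space (uniform_measure lborel {0<..<l})"
  using assms by (intro prob_space_uniform_measure) auto

text \<open>
  The measurable space of all probability laws on the natural numbers.
\<close>

abbreviation \<N> :: "nat measure measure" where
  "\<N> \<equiv> prob_algebra (count_space UNIV)"

lemma uniform_in_prob_algebra [measurable (raw)]:
  "uniform_measure lborel {0<..<1::real} \<in> space (prob_algebra borel)"
  by (simp add: space_prob_algebra prob_space_uniform_lborel)

lemma measurable_deposit_and_fill [measurable (raw)]:
  assumes [measurable]: "f \<in> M \<rightarrow>\<^sub>M \<N>" "g \<in> M \<rightarrow>\<^sub>M \<N>"
  shows "(\<lambda>x. deposit_and_fill (f x) (g x)) \<in> M \<rightarrow>\<^sub>M \<N>"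
  unfolding deposit_and_fill_def
  by measurable

lemma nn_integral_deposit_and_fill:
  assumes "M \<in> space \<N>" "N \<in> space \<N>"
  shows "(\<integral>\<^sup>+k. of_nat k \<partial>deposit_and_fill M N)
       = 1 + (\<integral>\<^sup>+k. of_nat k \<partial>M) + (\<integral>\<^sup>+k. of_nat k \<partial>N)"
proof -
  interpret M: prob_space M using assms(1) by (simp add: space_prob_algebra)
  interpret N: prob_space N using assms(2) by (simp add: space_prob_algebra)
  have sets[simp, measurable_cong]: "sets M = sets (count_space UNIV)" "sets N = sets (count_space UNIV)"
    using assms by (simp_all add: space_prob_algebra)
  note assms(2)[measurable]
  have 1: "(\<lambda>k. bind N (\<lambda>l. return (count_space UNIV) (1 + k + l)))
      \<in> M \<rightarrow>\<^sub>M subprob_algebra (count_space UNIV)"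
    by (intro measurable_prob_algebraD) measurable
  have 2: "(\<lambda>l. return (count_space UNIV) (1 + k + l))
      \<in> N \<rightarrow>\<^sub>M subprob_algebra (count_space UNIV)" for k :: nat
    by (intro measurable_prob_algebraD) measurable
  have "(\<integral>\<^sup>+k. of_nat k \<partial>deposit_and_fill M N)
      = (\<integral>\<^sup>+k. (\<integral>\<^sup>+l. of_nat (1 + k + l) \<partial>N) \<partial>M)"
    unfolding deposit_and_fill_def
    by (subst nn_integral_bind[OF _ 1], simp, subst nn_integral_bind[OF _ 2], simp)
      (simp add: nn_integral_return)
  also have "\<dots> = (\<integral>\<^sup>+k. (1 + of_nat k + (\<integral>\<^sup>+l. of_nat l \<partial>N)) \<partial>M)"
    by (simp add: nn_integral_add N.emeasure_space_1 flip: space_prob_algebra)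
  also have "\<dots> = 1 + (\<integral>\<^sup>+k. of_nat k \<partial>M) + (\<integral>\<^sup>+k. of_nat k \<partial>N)"
    by (simp add: nn_integral_add M.emeasure_space_1)
  finally show ?thesis .
qed

lemma nn_integral_bind_uniform:
  fixes l :: real
  assumes "0 < l" and f: "f \<in> borel \<rightarrow>\<^sub>M \<N>"
  shows "ennreal l * (\<integral>\<^sup>+k. of_nat k \<partial>bind (uniform_measure lborel {0<..<l}) f)
       = (\<integral>\<^sup>+\<tau>\<in>{0<..<l}. (\<integral>\<^sup>+k. of_nat k \<partial>f \<tau>) \<partial>lborel)"
proof -
  note [measurable] = measurable_prob_algebraD[OF f]
  have f': "f \<in> uniform_measure lborel {0<..<l} \<rightarrow>\<^sub>M subprob_algebra (count_space UNIV)" by measurable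
  have [measurable]: "(\<lambda>\<tau>. \<integral>\<^sup>+k. of_nat k \<partial>f \<tau>) \<in> borel_measurable borel"
    by (rule measurable_compose[OF measurable_prob_algebraD[OF f] nn_integral_measurable_subprob_algebra]) simp
  show ?thesis using assms(1)
    by (simp add: nn_integral_bind[OF _ f'] nn_integral_uniform_measure ennreal_times_divide
        ennreal_mult_divide_eq mult.commute[of "ennreal l"] flip: times_divide_eq_right)
qed

section \<open>Measurability of the particle numbers in the area\<close>

context trapezium_parking
begin

declare particles.simps [simp del]

lemma particles_Parallelogram_less: "x < a \<Longrightarrow> particles (Parallelogram x) = return (count_space UNIV) 0"
  by (simp only: particles.simps(1)[of x] if_True)
lemma particles_Parallelogram_eq: "particles (Parallelogram a) = return (count_space UNIV) 1"
  by (simp only: particles.simps(1)[of a] if_True if_False less_irrefl simp_thms)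
lemma particles_Trapezium_less: "x < (a + b) / 2 \<Longrightarrow> particles (Trapezium x) = return (count_space UNIV) 0"
  by (simp only: particles.simps(2)[of x] if_True)
lemma particles_Trapezium_eq: "particles (Trapezium ((a + b) / 2)) = return (count_space UNIV) 1"
  by (simp only: particles.simps(2)[of "(a + b) / 2"] if_True if_False less_irrefl simp_thms)

text \<open>
  The area of a particle.
\<close>

definition c :: real where "c = (a + b) / 2"

lemma c_pos: "0 < c" and c_le_a: "c \<le> a" and a_le_2c: "a \<le> 2 * c"
  using b_nonneg b_le_a a_pos by (auto simp: c_def)

text \<open>
  The law of the particle number, replaced by the law of \<open>0\<close> from area \<open>n * c\<close> on. As every deposition removes area \<open>c\<close>, the
  cut-off at \<open>n + 1\<close> is expressed by the cut-offs at \<open>n\<close>, so that measurability follows by induction on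
  \<open>n\<close>. A strip constructor is passed as an argument to treat both shapes at once.
\<close>

definition particles_below :: "nat \<Rightarrow> (real \<Rightarrow> strip) \<Rightarrow> real \<Rightarrow> nat measure" where
  "particles_below n S x = (if x < real n * c then particles (S x) else return (count_space UNIV) 0)"

lemma measurable_particles_below_Suc_Parallelogram:
  assumes P[measurable]: "particles_below n Parallelogram \<in> borel \<rightarrow>\<^sub>M \<N>"
    and T[measurable]: "particles_below n Trapezium \<in> borel \<rightarrow>\<^sub>M \<N>"
  shows "particles_below (Suc n) Parallelogram \<in> borel \<rightarrow>\<^sub>M \<N>"
proof -
  define G where "G x \<tau> =
      (if 0 < \<tau> \<and> \<tau> < x - a then
         deposit_and_fill (particles_below n Parallelogram \<tau>) (particles_below n Trapezium (x - \<tau> - (a + b) / 2))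
       else if x - a \<le> \<tau> \<and> \<tau> < 2 * x - 2 * a then
         deposit_and_fill (particles_below n Trapezium ((\<tau> + a - x) + (a - b) / 2))
           (particles_below n Parallelogram (x - ((\<tau> + a - x) + (a - b) / 2) - (a + b) / 2))
       else return (count_space UNIV) 0)" for x \<tau>
  have G[measurable]: "(\<lambda>(x, \<tau>). G x \<tau>) \<in> borel \<Otimes>\<^sub>M borel \<rightarrow>\<^sub>M \<N>"
    unfolding G_def by measurable
  have "particles_below (Suc n) Parallelogram = (\<lambda>x. if real (Suc n) * c \<le> x \<or> x < a then return (count_space UNIV) 0
      else if x = a then return (count_space UNIV) 1
      else bind (uniform_measure lborel {0<..<1}) (\<lambda>u. G x ((2 * x - 2 * a) * u)))" (is "_ = ?R")
  proof
    fix x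
    consider "real (Suc n) * c \<le> x \<or> x \<le> a" | "a < x" "x < real (Suc n) * c" by linarith
    then show "particles_below (Suc n) Parallelogram x = ?R x"
    proof cases
      case 1
      then show ?thesis
        by (auto simp: particles_below_def particles_Parallelogram_less particles_Parallelogram_eq simp del: One_nat_def)
    next
      case 2
      have x: "x - c < real n * c" using 2 by (simp add: algebra_simps)
      have "particles (Parallelogram x) = bind (uniform_measure lborel {0<..<2 * x - 2 * a}) (G x)"
        using 2 x c_le_a b_le_a b_nonneg
        by (simp only: particles.simps(1)[of x] if_not_P[of "x < a"] if_not_P[of "x = a"] not_less less_imp_le)
          (intro arg_cong2[where f=bind] refl ext, auto simp: G_def particles_below_def c_def field_simps)
      also have "\<dots> = bind (uniform_measure lborel {0<..<1}) (\<lambda>u. G x ((2 * x - 2 * a) * u))"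
        by (intro bind_uniform_rescale[where N="count_space UNIV"] measurable_prob_algebraD)
          (use 2 in auto)
      finally show ?thesis using 2 by (simp add: particles_below_def)
    qed
  qed
  also have "\<dots> \<in> borel \<rightarrow>\<^sub>M \<N>"
    using uniform_in_prob_algebra by measurable
  finally show ?thesis .
qed

lemma measurable_particles_below_Suc_Trapezium:
  assumes P[measurable]: "particles_below n Parallelogram \<in> borel \<rightarrow>\<^sub>M \<N>"
    and T[measurable]: "particles_below n Trapezium \<in> borel \<rightarrow>\<^sub>M \<N>"
  shows "particles_below (Suc n) Trapezium \<in> borel \<rightarrow>\<^sub>M \<N>"
proof -
  define G where "G x \<tau> =
      (if 0 < \<tau> \<and> \<tau> < x - (a + b) / 2 then
         deposit_and_fill (particles_below n Parallelogram \<tau>) (particles_below n Parallelogram (x - \<tau> - (a + b) / 2))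
       else return (count_space UNIV) 0)" for x \<tau>
  define H where "H x \<tau> =
      (if 0 < \<tau> \<and> \<tau> < x - (3 * a - b) / 2 then
         deposit_and_fill (particles_below n Trapezium (\<tau> + (a - b) / 2)) (particles_below n Trapezium (x - \<tau> - a))
       else if x - (3 * a - b) / 2 \<le> \<tau> \<and> \<tau> < 2 * x - 2 * a then
         deposit_and_fill (particles_below n Parallelogram (\<tau> - (x - (3 * a - b) / 2)))
           (particles_below n Parallelogram (x - (\<tau> - (x - (3 * a - b) / 2)) - (a + b) / 2))
       else return (count_space UNIV) 0)" for x \<tau>
  have G[measurable]: "(\<lambda>(x, \<tau>). G x \<tau>) \<in> borel \<Otimes>\<^sub>M borel \<rightarrow>\<^sub>M \<N>"
    unfolding G_def by measurable
  have H[measurable]: "(\<lambda>(x, \<tau>). H x \<tau>) \<in> borel \<Otimes>\<^sub>M borel \<rightarrow>\<^sub>M \<N>"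
    unfolding H_def by measurable
  have "particles_below (Suc n) Trapezium = (\<lambda>x.
      if real (Suc n) * c \<le> x \<or> x < (a + b) / 2 then return (count_space UNIV) 0
      else if x = (a + b) / 2 then return (count_space UNIV) 1
      else if x < (3 * a - b) / 2 then
        bind (uniform_measure lborel {0<..<1}) (\<lambda>u. G x ((x - (a + b) / 2) * u))
      else bind (uniform_measure lborel {0<..<1}) (\<lambda>u. H x ((2 * x - 2 * a) * u)))" (is "_ = ?R")
  proof
    fix x
    consider "real (Suc n) * c \<le> x \<or> x \<le> (a + b) / 2"
      | "(a + b) / 2 < x" "x < (3 * a - b) / 2" "x < real (Suc n) * c"
      | "(a + b) / 2 < x" "(3 * a - b) / 2 \<le> x" "x < real (Suc n) * c" by linarith
    then show "particles_below (Suc n) Trapezium x = ?R x"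
    proof cases
      case 1
      then show ?thesis
      proof (cases "x = (a + b) / 2")
        case True
        have "particles (Trapezium x) = return (count_space UNIV) 1"
          unfolding True by (rule particles_Trapezium_eq)
        note [simp] = this
        show ?thesis using True by (simp add: particles_below_def)
      next
        case False
        then show ?thesis using 1 by (auto simp: particles_below_def particles_Trapezium_less)
      qed
    next
      case 2
      have x: "x - c < real n * c" using 2 by (simp add: algebra_simps)
      have "particles (Trapezium x) = bind (uniform_measure lborel {0<..<x - (a + b) / 2}) (G x)"
        using 2 x c_le_a b_le_a b_nonneg
        by (simp only: particles.simps(2)[of x] if_not_P[of "x < (a + b) / 2"] if_not_P[of "x = (a + b) / 2"]
            if_P not_less less_imp_le)
          (intro arg_cong2[where f=bind] refl ext, auto simp: G_def particles_below_def c_def field_simps)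
      also have "\<dots> = bind (uniform_measure lborel {0<..<1}) (\<lambda>u. G x ((x - (a + b) / 2) * u))"
        by (intro bind_uniform_rescale[where N="count_space UNIV"] measurable_prob_algebraD)
          (use 2 in auto)
      finally show ?thesis using 2 by (simp add: particles_below_def)
    next
      case 3
      have x: "x - c < real n * c" using 3 by (simp add: algebra_simps)
      have "particles (Trapezium x) = bind (uniform_measure lborel {0<..<2 * x - 2 * a}) (H x)"
        using 3 x c_le_a b_le_a b_nonneg
        by (simp only: particles.simps(2)[of x] if_not_P[of "x < (a + b) / 2"] if_not_P[of "x = (a + b) / 2"]
            if_not_P[of "x < (3 * a - b) / 2"] not_less less_imp_le)
          (intro arg_cong2[where f=bind] refl ext, auto simp: H_def particles_below_def c_def field_simps)
      also have "\<dots> = bind (uniform_measure lborel {0<..<1}) (\<lambda>u. H x ((2 * x - 2 * a) * u))"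
        by (intro bind_uniform_rescale[where N="count_space UNIV"] measurable_prob_algebraD)
          (use 3 b_le_a in auto)
      finally show ?thesis using 3 by (simp add: particles_below_def)
    qed
  qed
  also have "\<dots> \<in> borel \<rightarrow>\<^sub>M \<N>"
    using uniform_in_prob_algebra by measurable
  finally show ?thesis .
qed

lemma measurable_particles_below:
  "particles_below n Parallelogram \<in> borel \<rightarrow>\<^sub>M \<N>" "particles_below n Trapezium \<in> borel \<rightarrow>\<^sub>M \<N>"
proof (induction n)
  case 0
  have "0 < a + b" using a_pos b_nonneg by simp
  then have "particles_below 0 S = (\<lambda>_. return (count_space UNIV) 0)" if "S = Parallelogram \<or> S = Trapezium" for S
    using that a_pos by (auto simp: particles_below_def particles_Parallelogram_less particles_Trapezium_less fun_eq_iff)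
  then show "particles_below 0 Parallelogram \<in> borel \<rightarrow>\<^sub>M \<N>" "particles_below 0 Trapezium \<in> borel \<rightarrow>\<^sub>M \<N>"
    by simp_all
qed (simp_all add: measurable_particles_below_Suc_Parallelogram measurable_particles_below_Suc_Trapezium)

lemma measurable_of_particles_below:
  assumes "\<And>n. particles_below n S \<in> borel \<rightarrow>\<^sub>M \<N>"
  shows "(\<lambda>x. particles (S x)) \<in> borel \<rightarrow>\<^sub>M \<N>"
proof (rule measurable_piecewise_restrict2[where A="\<lambda>n. {..<real n * c}"])
  show "space borel = (\<Union>n. {..<real n * c})"
    using reals_Archimedean3[OF c_pos] by auto
  show "\<exists>h\<in>borel \<rightarrow>\<^sub>M \<N>. \<forall>x\<in>{..<real n * c}. particles (S x) = h x" for n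
    by (intro bexI[OF _ assms[of n]]) (simp add: particles_below_def)
qed simp

lemma measurable_particles [measurable]:
  "(\<lambda>x. particles (Parallelogram x)) \<in> borel \<rightarrow>\<^sub>M \<N>"
  "(\<lambda>x. particles (Trapezium x)) \<in> borel \<rightarrow>\<^sub>M \<N>"
  using measurable_of_particles_below measurable_particles_below by blast+

lemma particles_in_prob_algebra: "particles S \<in> space \<N>"
  using measurable_particles[THEN measurable_space]
  by (cases S) (auto)

end

section \<open>The delay equation for the expected numbers of particles\<close>

context trapezium_parking
begin

text \<open>
  The expected number of particles on a strip, as an extended nonnegative real.
\<close>

definition mean :: "strip \<Rightarrow> ennreal" where
  "mean S = (\<integral>\<^sup>+k. of_nat k \<partial>particles S)"

lemma measurable_mean [measurable]:
  "(\<lambda>x. mean (Parallelogram x)) \<in> borel_measurable borel"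
  "(\<lambda>x. mean (Trapezium x)) \<in> borel_measurable borel"
  unfolding mean_def
  by (rule measurable_compose[OF measurable_prob_algebraD[OF measurable_particles(1)] nn_integral_measurable_subprob_algebra]
       measurable_compose[OF measurable_prob_algebraD[OF measurable_particles(2)] nn_integral_measurable_subprob_algebra], simp)+

lemma nn_integral_return_nat: "(\<integral>\<^sup>+k. of_nat k \<partial>return (count_space UNIV) (n::nat)) = of_nat n"
  by (simp add: nn_integral_return)

lemma mean_Parallelogram_less: "x < a \<Longrightarrow> mean (Parallelogram x) = 0"
  and mean_Parallelogram_eq: "mean (Parallelogram a) = 1"
  and mean_Trapezium_less: "x < c \<Longrightarrow> mean (Trapezium x) = 0"
  and mean_Trapezium_eq: "mean (Trapezium c) = 1"
  by (simp_all add: mean_def c_def nn_integral_return_nat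
      particles_Parallelogram_less particles_Parallelogram_eq particles_Trapezium_less particles_Trapezium_eq)

lemma mean_deposit:
  "(\<integral>\<^sup>+k. of_nat k \<partial>deposit_and_fill (particles S) (particles S')) = 1 + mean S + mean S'"
  by (simp add: nn_integral_deposit_and_fill particles_in_prob_algebra mean_def)

text \<open>
  The horizontal width of one slanted side of the particle.
\<close>

definition d :: real where "d = (a - b) / 2"

lemma a_minus_c: "a - c = d" by (simp add: c_def d_def field_simps)

lemma d_nonneg: "0 \<le> d" and d_le_c: "d \<le> c" and c_plus_d: "c + d = a"
  and two_d_le_a: "2 * d \<le> a"
  using b_nonneg b_le_a by (auto simp: c_def d_def field_simps)

text \<open>
  The recursions for the expected particle numbers, with the average multiplied out. The areas of the
  remaining strips are written in terms of \<open>a\<close>, \<open>c\<close> and \<open>d\<close>.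
\<close>

lemma mean_Parallelogram_average:
  assumes "a < x"
  shows "ennreal (2 * (x - a)) * mean (Parallelogram x) =
    (\<integral>\<^sup>+\<tau>\<in>{0<..<2 * (x - a)}.
       (if \<tau> < x - a then 1 + mean (Parallelogram \<tau>) + mean (Trapezium (x - c - \<tau>))
        else 1 + mean (Trapezium (\<tau> - (x - a - d))) + mean (Parallelogram (2 * (x - a) - \<tau>))) \<partial>lborel)"
proof -
  have cd: "(a + b) / 2 = c" "(a - b) / 2 = d" "x - \<tau> - c = x - c - \<tau>"
      "\<tau> + a - x + d = \<tau> - (x - a - d)" "x - c - (\<tau> - (x - a - d)) = 2 * (x - a) - \<tau>"
      "2 * x - 2 * a = 2 * (x - a)" for \<tau>
    by (simp_all add: c_def d_def field_simps)
  have "ennreal (2 * (x - a)) * mean (Parallelogram x) = ennreal (2 * (x - a)) *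
      (\<integral>\<^sup>+k. of_nat k \<partial>(bind (uniform_measure lborel {0<..<2 * (x - a)}) (\<lambda>\<tau>.
       if 0 < \<tau> \<and> \<tau> < x - a then
         deposit_and_fill (particles (Parallelogram \<tau>)) (particles (Trapezium (x - c - \<tau>)))
       else if x - a \<le> \<tau> \<and> \<tau> < 2 * (x - a) then
         deposit_and_fill (particles (Trapezium (\<tau> - (x - a - d))))
           (particles (Parallelogram (2 * (x - a) - \<tau>)))
       else return (count_space UNIV) 0)))"
    using assms by (simp only: mean_def particles.simps(1)[of x] cd if_not_P[of "x < a"] if_not_P[of "x = a"]
        not_less less_imp_le)
  also have "\<dots> = (\<integral>\<^sup>+\<tau>\<in>{0<..<2 * (x - a)}. (\<integral>\<^sup>+k. of_nat k \<partial>(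
       if 0 < \<tau> \<and> \<tau> < x - a then
         deposit_and_fill (particles (Parallelogram \<tau>)) (particles (Trapezium (x - c - \<tau>)))
       else if x - a \<le> \<tau> \<and> \<tau> < 2 * (x - a) then
         deposit_and_fill (particles (Trapezium (\<tau> - (x - a - d))))
           (particles (Parallelogram (2 * (x - a) - \<tau>)))
       else return (count_space UNIV) 0)) \<partial>lborel)"
    by (rule nn_integral_bind_uniform) (use assms in auto)
  also have "\<dots> = (\<integral>\<^sup>+\<tau>\<in>{0<..<2 * (x - a)}.
       (if \<tau> < x - a then 1 + mean (Parallelogram \<tau>) + mean (Trapezium (x - c - \<tau>))
        else 1 + mean (Trapezium (\<tau> - (x - a - d))) + mean (Parallelogram (2 * (x - a) - \<tau>))) \<partial>lborel)"
    by (rule nn_integral_interval_cong) (simp add: mean_deposit not_less)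
  finally show ?thesis .
qed

lemma mean_Trapezium_average_small:
  assumes "c < x" "x < a + d"
  shows "ennreal (x - c) * mean (Trapezium x) =
    (\<integral>\<^sup>+\<tau>\<in>{0<..<x - c}. 1 + mean (Parallelogram \<tau>) + mean (Parallelogram (x - c - \<tau>)) \<partial>lborel)"
proof -
  have cd: "(a + b) / 2 = c" "(3 * a - b) / 2 = a + d" "x - \<tau> - c = x - c - \<tau>" for \<tau>
    by (simp_all add: c_def d_def field_simps)
  have "ennreal (x - c) * mean (Trapezium x) = ennreal (x - c) *
      (\<integral>\<^sup>+k. of_nat k \<partial>(bind (uniform_measure lborel {0<..<x - c}) (\<lambda>\<tau>.
         if 0 < \<tau> \<and> \<tau> < x - c then
           deposit_and_fill (particles (Parallelogram \<tau>)) (particles (Parallelogram (x - c - \<tau>)))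
         else return (count_space UNIV) 0)))"
    using assms by (simp only: mean_def particles.simps(2)[of x] cd if_not_P[of "x < c"] if_not_P[of "x = c"]
        if_P not_less less_imp_le)
  also have "\<dots> = (\<integral>\<^sup>+\<tau>\<in>{0<..<x - c}. (\<integral>\<^sup>+k. of_nat k \<partial>(
         if 0 < \<tau> \<and> \<tau> < x - c then
           deposit_and_fill (particles (Parallelogram \<tau>)) (particles (Parallelogram (x - c - \<tau>)))
         else return (count_space UNIV) 0)) \<partial>lborel)"
    by (rule nn_integral_bind_uniform) (use assms in auto)
  also have "\<dots> = (\<integral>\<^sup>+\<tau>\<in>{0<..<x - c}. 1 + mean (Parallelogram \<tau>) + mean (Parallelogram (x - c - \<tau>)) \<partial>lborel)"
    by (rule nn_integral_interval_cong) (simp add: mean_deposit)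
  finally show ?thesis .
qed

lemma mean_Trapezium_average_large:
  assumes "c < x" "a + d \<le> x"
  shows "ennreal (2 * (x - a)) * mean (Trapezium x) =
    (\<integral>\<^sup>+\<tau>\<in>{0<..<2 * (x - a)}.
       (if \<tau> < x - a - d then 1 + mean (Trapezium (\<tau> + d)) + mean (Trapezium (x - a - \<tau>))
        else 1 + mean (Parallelogram (\<tau> - (x - a - d))) + mean (Parallelogram (2 * (x - a) - \<tau>))) \<partial>lborel)"
proof -
  have cd: "(a + b) / 2 = c" "(3 * a - b) / 2 = a + d" "x - \<tau> - a = x - a - \<tau>" "(a - b) / 2 = d"
      "x - (a + d) = x - a - d" "x - (\<tau> - (x - a - d)) - c = 2 * (x - a) - \<tau>"
      "2 * x - 2 * a = 2 * (x - a)" for \<tau>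
    by (simp_all add: c_def d_def field_simps)
  have pos: "0 < 2 * (x - a)" using assms c_plus_d d_nonneg by (cases "d = 0") auto
  have "ennreal (2 * (x - a)) * mean (Trapezium x) = ennreal (2 * (x - a)) *
      (\<integral>\<^sup>+k. of_nat k \<partial>(bind (uniform_measure lborel {0<..<2 * (x - a)}) (\<lambda>\<tau>.
         if 0 < \<tau> \<and> \<tau> < x - a - d then
           deposit_and_fill (particles (Trapezium (\<tau> + d))) (particles (Trapezium (x - a - \<tau>)))
         else if x - a - d \<le> \<tau> \<and> \<tau> < 2 * (x - a) then
           deposit_and_fill (particles (Parallelogram (\<tau> - (x - a - d))))
             (particles (Parallelogram (2 * (x - a) - \<tau>)))
         else return (count_space UNIV) 0)))"
    using assms by (simp only: mean_def particles.simps(2)[of x] cd if_not_P[of "x < c"] if_not_P[of "x = c"]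
        if_not_P[of "x < a + d"] not_less less_imp_le)
  also have "\<dots> = (\<integral>\<^sup>+\<tau>\<in>{0<..<2 * (x - a)}. (\<integral>\<^sup>+k. of_nat k \<partial>(
         if 0 < \<tau> \<and> \<tau> < x - a - d then
           deposit_and_fill (particles (Trapezium (\<tau> + d))) (particles (Trapezium (x - a - \<tau>)))
         else if x - a - d \<le> \<tau> \<and> \<tau> < 2 * (x - a) then
           deposit_and_fill (particles (Parallelogram (\<tau> - (x - a - d))))
             (particles (Parallelogram (2 * (x - a) - \<tau>)))
         else return (count_space UNIV) 0)) \<partial>lborel)"
    by (rule nn_integral_bind_uniform) (use pos in auto)
  also have "\<dots> = (\<integral>\<^sup>+\<tau>\<in>{0<..<2 * (x - a)}.
       (if \<tau> < x - a - d then 1 + mean (Trapezium (\<tau> + d)) + mean (Trapezium (x - a - \<tau>))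
        else 1 + mean (Parallelogram (\<tau> - (x - a - d))) + mean (Parallelogram (2 * (x - a) - \<tau>))) \<partial>lborel)"
    by (rule nn_integral_interval_cong) (simp add: mean_deposit not_less)
  finally show ?thesis .
qed

text \<open>
  As \<open>d \<le> c\<close>, the trapezia of area below \<open>d\<close> hold no particle, and the lower limit \<open>d\<close> may be
  replaced by \<open>0\<close>. This removes the shifts that depend on the shape.
\<close>

lemma nn_integral_mean_Trapezium_from_0:
  assumes "d \<le> q"
  shows "(\<integral>\<^sup>+u\<in>{d<..<q}. mean (Trapezium u) \<partial>lborel) = (\<integral>\<^sup>+u\<in>{0<..<q}. mean (Trapezium u) \<partial>lborel)"
proof -
  have "(\<integral>\<^sup>+u\<in>{0<..<d}. mean (Trapezium u) \<partial>lborel) = (\<integral>\<^sup>+u\<in>{0<..<d}. 0 \<partial>lborel)"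
    using d_le_c by (intro nn_integral_interval_cong) (simp add: mean_Trapezium_less)
  then show ?thesis
    using assms d_nonneg by (subst nn_integral_interval_split[of _ 0 d q]) auto
qed

text \<open>
  Upward and downward depositions contribute the same integrals, which cancels the factor \<open>2\<close>.
\<close>

lemma mean_Parallelogram_integral:
  assumes "a < x"
  shows "ennreal (x - a) * mean (Parallelogram x) = ennreal (x - a) +
    (\<integral>\<^sup>+u\<in>{0<..<x - a}. mean (Parallelogram u) \<partial>lborel) +
    (\<integral>\<^sup>+u\<in>{0<..<x - c}. mean (Trapezium u) \<partial>lborel)"
proof -
  define P where "P = (\<integral>\<^sup>+u\<in>{0<..<x - a}. mean (Parallelogram u) \<partial>lborel)"
  define T where "T = (\<integral>\<^sup>+u\<in>{d<..<x - c}. mean (Trapezium u) \<partial>lborel)"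
  have up: "(\<integral>\<^sup>+\<tau>\<in>{0<..<x - a}. 1 + mean (Parallelogram \<tau>) + mean (Trapezium (x - c - \<tau>)) \<partial>lborel)
      = ennreal (x - a) + P + T"
    using assms by (simp add: nn_integral_interval_add nn_integral_interval_const P_def T_def a_minus_c
      nn_integral_interval_reflect[of "\<lambda>u. mean (Trapezium u)"])
  have down: "(\<integral>\<^sup>+\<tau>\<in>{x - a<..<2 * (x - a)}. 1 + mean (Trapezium (\<tau> - (x - a - d)))
        + mean (Parallelogram (2 * (x - a) - \<tau>)) \<partial>lborel)
      = ennreal (x - a) + T + P"
  proof -
    have "2 * (x - a) - (x - a - d) = x - c" using c_plus_d by simp
    then show ?thesis
      using assms by (simp add: nn_integral_interval_add nn_integral_interval_const P_def T_def
        nn_integral_interval_shift[of "\<lambda>u. mean (Trapezium u)"]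
        nn_integral_interval_reflect[of "\<lambda>u. mean (Parallelogram u)"])
  qed
  have "ennreal (2 * (x - a)) * mean (Parallelogram x)
      = (ennreal (x - a) + P + T) + (ennreal (x - a) + T + P)"
    unfolding mean_Parallelogram_average[OF assms]
    by (subst nn_integral_interval_two_branches, simp_all only: up down) (use assms in simp_all)
  also have "\<dots> = 2 * (ennreal (x - a) + P + T)" by (simp only: mult_2 add_ac)
  finally have "ennreal (2 * (x - a)) * mean (Parallelogram x) = 2 * (ennreal (x - a) + P + T)" .
  moreover have two: "ennreal (2 * (x - a)) = 2 * ennreal (x - a)"
    using assms by (subst ennreal_mult) auto
  ultimately have "2 * (ennreal (x - a) * mean (Parallelogram x)) = 2 * (ennreal (x - a) + P + T)"
    by (simp only: mult.assoc)
  then have "ennreal (x - a) * mean (Parallelogram x) = ennreal (x - a) + P + T"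
    by (rule ennreal_double_cancel)
  moreover have "T = (\<integral>\<^sup>+u\<in>{0<..<x - c}. mean (Trapezium u) \<partial>lborel)"
    unfolding T_def using assms c_plus_d by (intro nn_integral_mean_Trapezium_from_0) simp
  ultimately show ?thesis by (simp add: P_def)
qed

lemma mean_Trapezium_integral:
  assumes "c < x" "a + d \<le> x"
  shows "ennreal (x - a) * mean (Trapezium x) = ennreal (x - a) +
    (\<integral>\<^sup>+u\<in>{0<..<x - a}. mean (Trapezium u) \<partial>lborel) +
    (\<integral>\<^sup>+u\<in>{0<..<x - c}. mean (Parallelogram u) \<partial>lborel)"
proof -
  have ax: "a < x" using assms c_plus_d d_nonneg by (cases "d = 0") auto
  define P where "P = (\<integral>\<^sup>+u\<in>{0<..<x - c}. mean (Parallelogram u) \<partial>lborel)"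
  define T where "T = (\<integral>\<^sup>+u\<in>{d<..<x - a}. mean (Trapezium u) \<partial>lborel)"
  have two: "ennreal (2 * (x - a)) = 2 * ennreal (x - a)"
    using ax by (subst ennreal_mult) auto
  have eq: "2 * (x - a) - (x - a - d) = x - c" using c_plus_d by simp
  have up: "(\<integral>\<^sup>+\<tau>\<in>{0<..<x - a - d}. 1 + mean (Trapezium (\<tau> + d)) + mean (Trapezium (x - a - \<tau>)) \<partial>lborel)
      = ennreal (x - a - d) + T + T"
  proof -
    have "(\<integral>\<^sup>+\<tau>\<in>{0<..<x - a - d}. mean (Trapezium (\<tau> - - d)) \<partial>lborel)
        = (\<integral>\<^sup>+u\<in>{0 - - d<..<x - a - d - - d}. mean (Trapezium u) \<partial>lborel)"
      by (rule nn_integral_interval_shift) simp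
    then have "(\<integral>\<^sup>+\<tau>\<in>{0<..<x - a - d}. mean (Trapezium (\<tau> + d)) \<partial>lborel) = T"
      by (simp add: T_def)
    moreover have "(\<integral>\<^sup>+\<tau>\<in>{0<..<x - a - d}. mean (Trapezium (x - a - \<tau>)) \<partial>lborel) = T"
      by (simp add: nn_integral_interval_reflect[of "\<lambda>u. mean (Trapezium u)"] T_def)
    ultimately show ?thesis
      using assms by (simp add: nn_integral_interval_add nn_integral_interval_const)
  qed
  have down: "(\<integral>\<^sup>+\<tau>\<in>{x - a - d<..<2 * (x - a)}. 1 + mean (Parallelogram (\<tau> - (x - a - d)))
        + mean (Parallelogram (2 * (x - a) - \<tau>)) \<partial>lborel)
      = ennreal (x - c) + P + P"
    using assms eq by (simp add: nn_integral_interval_add nn_integral_interval_const P_def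
      nn_integral_interval_shift[of "\<lambda>u. mean (Parallelogram u)"]
      nn_integral_interval_reflect[of "\<lambda>u. mean (Parallelogram u)"])
  have "ennreal (2 * (x - a)) * mean (Trapezium x)
      = (ennreal (x - a - d) + T + T) + (ennreal (x - c) + P + P)"
    unfolding mean_Trapezium_average_large[OF assms]
    by (subst nn_integral_interval_two_branches, simp_all only: up down)
      (use ax assms d_nonneg in simp_all)
  also have "\<dots> = (ennreal (x - a - d) + ennreal (x - c)) + 2 * (T + P)"
    by (simp only: mult_2 add_ac)
  also have "ennreal (x - a - d) + ennreal (x - c) = 2 * ennreal (x - a)"
  proof -
    have "x - a - d + (x - c) = 2 * (x - a)" using c_plus_d by simp
    moreover have "ennreal (x - a - d) + ennreal (x - c) = ennreal (x - a - d + (x - c))"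
      using assms ax by (intro ennreal_plus[symmetric]) auto
    ultimately show ?thesis using two by (simp only:)
  qed
  finally have "ennreal (2 * (x - a)) * mean (Trapezium x) = 2 * ennreal (x - a) + 2 * (T + P)" .
  with two have "2 * (ennreal (x - a) * mean (Trapezium x)) = 2 * (ennreal (x - a) + T + P)"
    by (simp only: mult.assoc distrib_left add.assoc)
  then have "ennreal (x - a) * mean (Trapezium x) = ennreal (x - a) + T + P"
    by (rule ennreal_double_cancel)
  moreover have "T = (\<integral>\<^sup>+u\<in>{0<..<x - a}. mean (Trapezium u) \<partial>lborel)"
    unfolding T_def using assms by (intro nn_integral_mean_Trapezium_from_0) simp
  ultimately show ?thesis by (simp add: P_def)
qed

text \<open>
  For \<open>x < a + d\<close> the two remaining parallelograms have areas below \<open>x - c < 2 * d \<le> a\<close>, so nothing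
  fits into them.
\<close>

lemma mean_Trapezium_small:
  assumes "c \<le> x" "x < a + d"
  shows "mean (Trapezium x) = 1"
proof (cases "x = c")
  case False
  have "ennreal (x - c) * mean (Trapezium x) = (\<integral>\<^sup>+\<tau>\<in>{0<..<x - c}.
      1 + mean (Parallelogram \<tau>) + mean (Parallelogram (x - c - \<tau>)) \<partial>lborel)"
    using assms False by (intro mean_Trapezium_average_small) auto
  also have "\<dots> = (\<integral>\<^sup>+\<tau>\<in>{0<..<x - c}. 1 \<partial>lborel)"
    using assms two_d_le_a c_plus_d
    by (intro nn_integral_interval_cong) (simp add: mean_Parallelogram_less)
  also have "\<dots> = ennreal (x - c) * 1" using assms by simp
  finally show ?thesis using assms False by (subst (asm) ennreal_mult_cancel_left) auto
qed (simp add: mean_Trapezium_eq)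

text \<open>
  The sum of the two expectations, that is, \<open>2 * \<eta> x\<close>. Unlike its two summands it satisfies an equation
  of its own.
\<close>

definition expected_total :: "real \<Rightarrow> ennreal" where
  "expected_total x = mean (Parallelogram x) + mean (Trapezium x)"

lemma measurable_expected_total [measurable]: "expected_total \<in> borel_measurable borel"
  unfolding expected_total_def by measurable

lemma expected_total_less: "x < c \<Longrightarrow> expected_total x = 0"
  using c_le_a by (simp add: expected_total_def mean_Parallelogram_less mean_Trapezium_less)

lemma expected_total_between: "c \<le> x \<Longrightarrow> x < a \<Longrightarrow> expected_total x = 1"
  using d_nonneg by (simp add: expected_total_def mean_Parallelogram_less mean_Trapezium_small)

lemma expected_total_integral:
  assumes "a < x"
  shows "ennreal (x - a) * expected_total x = 2 * ennreal (x - a) +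
    (\<integral>\<^sup>+u\<in>{0<..<x - a}. expected_total u \<partial>lborel) + (\<integral>\<^sup>+u\<in>{0<..<x - c}. expected_total u \<partial>lborel)"
proof -
  have "ennreal (x - a) * mean (Trapezium x) = ennreal (x - a) +
    (\<integral>\<^sup>+u\<in>{0<..<x - a}. mean (Trapezium u) \<partial>lborel) +
    (\<integral>\<^sup>+u\<in>{0<..<x - c}. mean (Parallelogram u) \<partial>lborel)"
  proof (cases "a + d \<le> x")
    case True
    then show ?thesis using assms c_le_a by (intro mean_Trapezium_integral) auto
  next
    case False
    have "(\<integral>\<^sup>+u\<in>{0<..<x - a}. mean (Trapezium u) \<partial>lborel) = (\<integral>\<^sup>+u\<in>{0<..<x - a}. 0 \<partial>lborel)"
      using False d_le_c by (intro nn_integral_interval_cong) (simp add: mean_Trapezium_less)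
    moreover have "(\<integral>\<^sup>+u\<in>{0<..<x - c}. mean (Parallelogram u) \<partial>lborel) = (\<integral>\<^sup>+u\<in>{0<..<x - c}. 0 \<partial>lborel)"
      using False two_d_le_a a_minus_c
      by (intro nn_integral_interval_cong) (simp add: mean_Parallelogram_less)
    ultimately show ?thesis
      using False assms c_le_a by (simp add: mean_Trapezium_small)
  qed
  then have "ennreal (x - a) * expected_total x = ennreal (x - a) +
    (\<integral>\<^sup>+u\<in>{0<..<x - a}. mean (Parallelogram u) \<partial>lborel) +
    (\<integral>\<^sup>+u\<in>{0<..<x - c}. mean (Trapezium u) \<partial>lborel) + (ennreal (x - a) +
    (\<integral>\<^sup>+u\<in>{0<..<x - a}. mean (Trapezium u) \<partial>lborel) +
    (\<integral>\<^sup>+u\<in>{0<..<x - c}. mean (Parallelogram u) \<partial>lborel))"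
    unfolding expected_total_def distrib_left mean_Parallelogram_integral[OF assms] by simp
  then show ?thesis
    by (simp add: expected_total_def nn_integral_interval_add del: nn_integral_indicator) (simp add: mult_2 ac_simps)
qed

text \<open>
  Every particle occupies area \<open>c\<close>. The induction on \<open>n\<close> follows the recursion, which lowers the area by
  at least \<open>c\<close>.
\<close>

lemma mean_le_aux:
  "x < real n * c \<Longrightarrow> mean (Parallelogram x) \<le> ennreal (x / c) \<and> mean (Trapezium x) \<le> ennreal (x / c)"
proof (induction n arbitrary: x)
  case 0
  then show ?case using a_pos c_pos by (simp add: mean_Parallelogram_less mean_Trapezium_less)
next
  case (Suc n)
  have IH: "mean (Parallelogram u) \<le> ennreal (u / c)" "mean (Trapezium u) \<le> ennreal (u / c)"
    if "u \<le> x - c" for u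
    using Suc.IH[of u] Suc.prems that by (auto simp: algebra_simps)
  have sum: "1 + M + N \<le> ennreal (x / c)"
    if "M \<le> ennreal (u / c)" "N \<le> ennreal (v / c)" "0 \<le> u" "0 \<le> v" "u + v = x - c" for M N u v
  proof -
    have "1 + M + N \<le> 1 + ennreal (u / c) + ennreal (v / c)"
      using that by (intro add_mono) auto
    also have "\<dots> = ennreal (1 + u / c + v / c)"
      using that c_pos by (simp flip: ennreal_plus ennreal_1)
    also have "1 + u / c + v / c = x / c"
      using that(5) c_pos by (simp add: field_simps)
    finally show ?thesis .
  qed
  note facts = d_nonneg d_le_c c_plus_d c_le_a c_pos
  have "mean (Parallelogram x) \<le> ennreal (x / c)"
  proof -
    consider "x < a" | "x = a" | "a < x" by linarith
    then show ?thesis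
    proof cases
      case 3
      show ?thesis
      proof (rule average_le[OF _ mean_Parallelogram_average[OF 3]])
        fix \<tau> assume \<tau>: "0 < \<tau>" "\<tau> < 2 * (x - a)"
        show "(if \<tau> < x - a then 1 + mean (Parallelogram \<tau>) + mean (Trapezium (x - c - \<tau>))
          else 1 + mean (Trapezium (\<tau> - (x - a - d))) + mean (Parallelogram (2 * (x - a) - \<tau>)))
          \<le> ennreal (x / c)"
          using \<tau> facts by (auto intro!: sum[OF IH(1) IH(2)] sum[OF IH(2) IH(1)])
      qed (use 3 in simp)
    qed (use facts in \<open>simp_all add: mean_Parallelogram_less mean_Parallelogram_eq\<close>)
  qed
  moreover have "mean (Trapezium x) \<le> ennreal (x / c)"
  proof -
    consider "x < c" | "x = c" | "c \<le> x" "x < a + d" | "c < x" "a + d \<le> x" "a < x"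
      using c_plus_d d_nonneg by linarith
    then show ?thesis
    proof cases
      case 4
      show ?thesis
      proof (rule average_le[OF _ mean_Trapezium_average_large[OF 4(1,2)]])
        fix \<tau> assume \<tau>: "0 < \<tau>" "\<tau> < 2 * (x - a)"
        show "(if \<tau> < x - a - d then 1 + mean (Trapezium (\<tau> + d)) + mean (Trapezium (x - a - \<tau>))
          else 1 + mean (Parallelogram (\<tau> - (x - a - d))) + mean (Parallelogram (2 * (x - a) - \<tau>)))
          \<le> ennreal (x / c)"
          using \<tau> facts by (auto intro!: sum[OF IH(1) IH(1)] sum[OF IH(2) IH(2)])
      qed (use 4 in simp)
    qed (use facts in \<open>simp_all add: mean_Trapezium_less mean_Trapezium_eq mean_Trapezium_small\<close>)
  qed
  ultimately show ?case ..
qed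

lemma mean_le: "mean (Parallelogram x) \<le> ennreal (x / c)" "mean (Trapezium x) \<le> ennreal (x / c)"
  using mean_le_aux reals_Archimedean3[OF c_pos] by blast+

lemma expected_total_le: "expected_total x \<le> ennreal (2 * x / c)"
proof (cases "0 \<le> x")
  case True
  have "expected_total x \<le> ennreal (x / c) + ennreal (x / c)"
    unfolding expected_total_def by (intro add_mono mean_le)
  also have "\<dots> = ennreal (2 * x / c)"
    using True c_pos by (simp flip: ennreal_plus)
  finally show ?thesis .
qed (use c_pos in \<open>simp add: expected_total_less\<close>)

lemma expectation_eq_mean: "(\<integral>k. real k \<partial>particles S) = enn2real (mean S)"
proof -
  have "sets (particles S) = sets (count_space UNIV)"
    using particles_in_prob_algebra by (simp add: space_prob_algebra)
  note [measurable_cong] = this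
  show ?thesis unfolding mean_def
    by (subst integral_eq_nn_integral) (auto simp flip: ennreal_of_nat_eq_real_of_nat)
qed

lemma eta_eq_expected_total: "\<eta> x = enn2real (expected_total x) / 2"
proof -
  have "mean S < \<top>" if "S = Parallelogram x \<or> S = Trapezium x" for S
    using that mean_le[of x] by (auto simp: less_top[symmetric] top_unique)
  then show ?thesis
    by (simp add: \<eta>_def expectation_eq_mean expected_total_def enn2real_plus)
qed

end

section \<open>The exponential factor of the parking constant\<close>

text \<open>
  The parameter \<open>\<gamma>\<close> stands for \<open>c / a\<close>, the area of a particle divided by the length of its longer base.
\<close>

locale parking_exponent =
  fixes \<gamma> :: real
  assumes \<gamma>_ge: "1 / 2 \<le> \<gamma>" and \<gamma>_le: "\<gamma> \<le> 1"
begin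

text \<open>
  The integrand of the exponent. Division by zero gives it the value \<open>0\<close> at \<open>s = 0\<close>, where the limit is
  \<open>- 1 - \<gamma>\<close>; it is therefore bounded but not continuous there.
\<close>

definition rate :: "real \<Rightarrow> real" where
  "rate s = (- 2 + exp (- (s * \<gamma>)) + exp (- s)) / s"

text \<open>
  The exponential factor. For \<open>t \<le> 0\<close> it equals \<open>1\<close>.
\<close>

definition E :: "real \<Rightarrow> real" where
  "E t = exp (LBINT s:{0..t}. rate s)"

lemma rate_bounds:
  assumes "0 \<le> s"
  shows "- 2 \<le> rate s" "rate s \<le> 0"
proof -
  have "1 - s * \<gamma> \<le> exp (- (s * \<gamma>))" "1 - s \<le> exp (- s)"
    using exp_ge_add_one_self[of "- (s * \<gamma>)"] exp_ge_add_one_self[of "- s"] by auto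
  moreover have "s * \<gamma> \<le> s" using assms \<gamma>_le by (simp add: mult_left_le)
  moreover have "exp (- (s * \<gamma>)) \<le> 1" "exp (- s) \<le> 1" using assms \<gamma>_ge by auto
  ultimately have "- 2 * s \<le> - 2 + exp (- (s * \<gamma>)) + exp (- s)"
      "- 2 + exp (- (s * \<gamma>)) + exp (- s) \<le> 0" by linarith+
  then show "- 2 \<le> rate s" "rate s \<le> 0"
    using assms unfolding rate_def
    by (cases "s = 0", simp_all only: le_divide_eq divide_le_0_iff, auto)+
qed

lemma measurable_rate [measurable]: "rate \<in> borel_measurable borel"
  unfolding rate_def by measurable

lemma set_integrable_rate: "set_integrable lborel {0..t} rate"
  unfolding set_integrable_def
proof (rule integrableI_bounded_set[where A="{0..t}" and B=2])
  show "emeasure lborel {0..t} < \<infinity>" by (simp add: emeasure_lborel_Icc_eq)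
  show "AE x\<in>{0..t} in lborel. norm (indicator {0..t} x *\<^sub>R rate x) \<le> 2"
    using rate_bounds by (intro AE_I2) (auto simp: indicator_def abs_le_iff minus_le_iff)
qed (auto simp: indicator_def)

lemma E_eq_integral: "E t = exp (integral {0..t} rate)"
  unfolding E_def using set_borel_integral_eq_integral(2)[OF set_integrable_rate] by simp

lemma rate_integrable_on: "rate integrable_on {0..t}"
  using set_borel_integral_eq_integral(1)[OF set_integrable_rate] .

lemma E_pos: "0 < E t" by (simp add: E_def)

lemma E_bounds:
  assumes "0 \<le> t"
  shows "exp (- 2 * t) \<le> E t" "E t \<le> 1"
proof -
  have "integral {0..t} (\<lambda>_. - 2) \<le> integral {0..t} rate"
    using rate_bounds by (intro integral_le rate_integrable_on) auto
  then show "exp (- 2 * t) \<le> E t" using assms by (simp add: E_eq_integral)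
  have "integral {0..t} rate \<le> integral {0..t} (\<lambda>_. 0)"
    using rate_bounds by (intro integral_le rate_integrable_on) auto
  then show "E t \<le> 1" by (simp add: E_eq_integral)
qed

lemma E_nonpos: "t \<le> 0 \<Longrightarrow> E t = 1"
  by (cases "t = 0") (simp_all add: E_eq_integral)

lemma E_le_1: "E t \<le> 1"
  using E_bounds(2)[of t] E_nonpos[of t] by (cases "0 \<le> t") auto

lemma E_has_derivative:
  assumes "0 < t"
  shows "(E has_real_derivative rate t * E t) (at t)"
proof -
  (* The integral is split at \<delta>, away from the discontinuity of the rate at 0. *)
  define \<delta> where "\<delta> = t / 2"
  have \<delta>: "0 < \<delta>" "\<delta> < t" using assms by (auto simp: \<delta>_def)
  have "continuous_on {\<delta>..t + 1} rate"
    unfolding rate_def using \<delta> by (intro continuous_intros) auto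
  then have "((\<lambda>x. integral {\<delta>..x} rate) has_real_derivative rate t) (at t within {\<delta>..t + 1})"
    by (rule integral_has_real_derivative) (use \<delta> in auto)
  moreover have "at t within {\<delta>..t + 1} = at t"
    using \<delta> by (intro at_within_interior) auto
  ultimately have "((\<lambda>x. integral {\<delta>..x} rate) has_real_derivative rate t) (at t)" by simp
  then have deriv: "((\<lambda>x. exp (integral {0..\<delta>} rate + integral {\<delta>..x} rate)) has_real_derivative
      rate t * exp (integral {0..\<delta>} rate + integral {\<delta>..t} rate)) (at t)"
    by (auto intro!: derivative_eq_intros)
  have comb: "integral {0..\<delta>} rate + integral {\<delta>..x} rate = integral {0..x} rate" if "\<delta> \<le> x" for x
    using \<delta> that by (intro Henstock_Kurzweil_Integration.integral_combine rate_integrable_on) auto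
  have "\<forall>\<^sub>F x in nhds t. exp (integral {0..\<delta>} rate + integral {\<delta>..x} rate) = E x"
    using eventually_nhds_in_open[of "{\<delta><..}" t] \<delta>
    by (auto elim!: eventually_mono simp: E_eq_integral comb)
  then have "(E has_real_derivative
      rate t * exp (integral {0..\<delta>} rate + integral {\<delta>..t} rate)) (at t)"
    by (rule DERIV_cong_ev[THEN iffD1, OF refl _ refl deriv])
  then show ?thesis using \<delta> by (simp only: comb E_eq_integral less_imp_le)
qed

lemma E_isCont: "isCont E t"
proof -
  consider "0 < t" | "t < 0" | "t = 0" by linarith
  then show ?thesis
  proof cases
    case 1
    then show ?thesis using E_has_derivative DERIV_isCont by blast
  next
    case 2
    have "\<forall>\<^sub>F x in nhds t. E x = 1"
      using eventually_nhds_in_open[of "{..<0}" t] 2 by (auto elim!: eventually_mono simp: E_nonpos)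
    then show ?thesis using isCont_cong[of E "\<lambda>_. 1" t] by simp
  next
    case 3
    have "(E \<longlongrightarrow> 1) (at 0)"
    proof (rule tendsto_sandwich[OF always_eventually always_eventually])
      show "\<forall>t. exp (- 2 * \<bar>t\<bar>) \<le> E t"
        using E_bounds(1) E_nonpos by (smt (verit) exp_le_one_iff)
      show "\<forall>t. E t \<le> 1" using E_le_1 by blast
      show "((\<lambda>t::real. exp (- 2 * \<bar>t\<bar>)) \<longlongrightarrow> 1) (at 0)"
        by (auto intro!: tendsto_eq_intros)
    qed simp
    then show ?thesis using 3 by (simp add: isCont_def E_nonpos)
  qed
qed

lemma measurable_E [measurable]: "E \<in> borel_measurable borel"
  using E_isCont by (intro borel_measurable_continuous_onI) (auto simp: continuous_on_eq_continuous_at)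

text \<open>
  The derivative of \<open>t\<^sup>2 * E t\<close>. It is nonnegative, in contrast to that of \<open>t * E t\<close>; this allows
  \<open>t\<^sup>2 * E t\<close> to be written as a nonnegative integral.
\<close>

definition square_E_rate :: "real \<Rightarrow> real" where
  "square_E_rate t = (exp (- t) + exp (- (t * \<gamma>))) * (t * E t)"

lemma measurable_square_E_rate [measurable]: "square_E_rate \<in> borel_measurable borel"
  unfolding square_E_rate_def by measurable

lemma square_E_rate_nonneg: "0 \<le> t \<Longrightarrow> 0 \<le> square_E_rate t"
  using E_pos[of t] by (simp add: square_E_rate_def)

lemma square_E_has_derivative:
  assumes "0 \<le> t"
  shows "((\<lambda>t. t\<^sup>2 * E t) has_real_derivative square_E_rate t) (at t)"
proof (cases "t = 0")
  case True
  have "(\<lambda>h. h * E h) \<midarrow>0\<rightarrow> 0"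
    using E_isCont[of 0] by (auto intro!: tendsto_eq_intros simp: isCont_def)
  then show ?thesis using True
    by (simp add: has_field_derivative_iff square_E_rate_def power2_eq_square mult.assoc cong: LIM_cong)
next
  case False
  then show ?thesis using assms
    by (auto intro!: derivative_eq_intros E_has_derivative simp: square_E_rate_def rate_def field_simps power2_eq_square)
qed

lemma square_E_eq:
  assumes "0 \<le> t"
  shows "ennreal (t\<^sup>2 * E t) = (\<integral>\<^sup>+r\<in>{0..t}. ennreal (square_E_rate r) \<partial>lborel)"
  using assms square_E_has_derivative square_E_rate_nonneg
  by (subst nn_integral_FTC_Icc[where F="\<lambda>t. t\<^sup>2 * E t"]) auto

lemma E_times_has_derivative:
  assumes "0 < t"
  shows "((\<lambda>t. t * E t) has_real_derivative (- 1 + exp (- t) + exp (- (t * \<gamma>))) * E t) (at t)"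
  using assms by (auto intro!: derivative_eq_intros E_has_derivative simp: rate_def field_simps)

end

section \<open>Laplace transforms of nonnegative functions\<close>

lemma nn_integral_times_exp:
  fixes z :: real
  assumes "0 < z"
  shows "(\<integral>\<^sup>+t\<in>{0..}. ennreal (t * exp (- (z * t))) \<partial>lborel) = ennreal (1 / z\<^sup>2)"
proof -
  have "((\<lambda>t. - (t / z + 1 / z\<^sup>2) * exp (- (z * t))) \<longlongrightarrow> 0) at_top"
    using assms by real_asymp
  moreover have "((\<lambda>t. - (t / z + 1 / z\<^sup>2) * exp (- (z * t))) has_real_derivative t * exp (- (z * t))) (at t)" for t
    using assms by (auto intro!: derivative_eq_intros simp: field_simps power2_eq_square)
  ultimately show ?thesis
    using assms by (subst nn_integral_FTC_atLeast[where F="\<lambda>t. - (t / z + 1 / z\<^sup>2) * exp (- (z * t))" and T=0]) auto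
qed

lemma nn_integral_exp_tail:
  fixes z r :: real
  assumes "0 < z"
  shows "(\<integral>\<^sup>+t\<in>{r..}. ennreal (z * exp (- (z * t))) \<partial>lborel) = ennreal (exp (- (z * r)))"
proof -
  have "((\<lambda>t. - exp (- (z * t))) \<longlongrightarrow> 0) at_top" using assms by real_asymp
  then show ?thesis using assms
    by (subst nn_integral_FTC_atLeast[where F="\<lambda>t. - exp (- (z * t))" and T=0])
      (auto intro!: derivative_eq_intros)
qed

text \<open>
  The Laplace transform of a nonnegative function on the half-line; the values of \<open>h\<close> at negative
  arguments are ignored.
\<close>

definition LT :: "(real \<Rightarrow> ennreal) \<Rightarrow> real \<Rightarrow> ennreal" where
  "LT h z = (\<integral>\<^sup>+t\<in>{0..}. h t * ennreal (exp (- (z * t))) \<partial>lborel)"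

lemma measurable_LT [measurable (raw)]:
  assumes [measurable]: "h \<in> borel_measurable borel" "g \<in> borel_measurable M"
  shows "(\<lambda>x. LT h (g x)) \<in> borel_measurable M"
  unfolding LT_def by measurable

lemma LT_cong: "(\<And>t. 0 \<le> t \<Longrightarrow> h t = h' t) \<Longrightarrow> LT h z = LT h' z"
  unfolding LT_def by (intro nn_integral_cong) (auto simp: indicator_def)

lemma LT_mono: "(\<And>t. 0 \<le> t \<Longrightarrow> h t \<le> h' t) \<Longrightarrow> LT h z \<le> LT h' z"
  unfolding LT_def by (intro nn_integral_mono) (auto simp: indicator_def intro!: mult_right_mono)

lemma LT_antimono: "p \<le> q \<Longrightarrow> LT h q \<le> LT h p"
  unfolding LT_def
  by (intro nn_integral_mono)
    (auto simp: indicator_def intro!: mult_left_mono ennreal_leI mult_right_mono)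

lemma LT_add:
  assumes [measurable]: "h \<in> borel_measurable borel" "h' \<in> borel_measurable borel"
  shows "LT (\<lambda>t. h t + h' t) z = LT h z + LT h' z"
  unfolding LT_def by (simp add: distrib_right nn_integral_add)

lemma LT_exp_mult: "LT (\<lambda>t. ennreal (exp (- (q * t))) * h t) z = LT h (z + q)"
  unfolding LT_def
proof (intro nn_integral_cong)
  fix t :: real
  have "ennreal (exp (- (q * t))) * ennreal (exp (- (z * t))) = ennreal (exp (- ((z + q) * t)))"
    by (simp flip: ennreal_mult exp_add add: algebra_simps)
  then show "ennreal (exp (- (q * t))) * h t * ennreal (exp (- (z * t))) * indicator {0..} t
      = h t * ennreal (exp (- ((z + q) * t))) * indicator {0..} t"
    by (simp add: ac_simps)
qed

lemma exp_difference_eq_nn_integral: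
  fixes p q t :: real
  assumes "p \<le> q" "0 \<le> t"
  shows "ennreal (exp (- (p * t))) = ennreal (exp (- (q * t)))
    + (\<integral>\<^sup>+u\<in>{p<..<q}. ennreal (t * exp (- (u * t))) \<partial>lborel)"
proof -
  have "(\<integral>\<^sup>+u\<in>{p..q}. ennreal (t * exp (- (u * t))) \<partial>lborel) = - exp (- (q * t)) - (- exp (- (p * t)))"
    using assms
    by (intro nn_integral_FTC_Icc[where F="\<lambda>u. - exp (- (u * t))"]) (auto intro!: derivative_eq_intros)
  moreover have "exp (- (q * t)) \<le> exp (- (p * t))"
    using assms by (simp add: mult_right_mono)
  ultimately show ?thesis
    by (simp add: nn_integral_interval_closed flip: ennreal_plus)
qed

text \<open>
  Multiplication by \<open>t\<close> is minus differentiation of the transform, stated in integrated form.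
\<close>

lemma LT_difference:
  assumes [measurable]: "h \<in> borel_measurable borel" and "p \<le> q"
  shows "LT h p = LT h q + (\<integral>\<^sup>+u\<in>{p<..<q}. LT (\<lambda>t. ennreal t * h t) u \<partial>lborel)"
proof -
  have "(\<integral>\<^sup>+u\<in>{p<..<q}. LT (\<lambda>t. ennreal t * h t) u \<partial>lborel)
      = (\<integral>\<^sup>+u. (\<integral>\<^sup>+t. ennreal t * h t * ennreal (exp (- (u * t))) * indicator {0..} t
           * indicator {p<..<q} u \<partial>lborel) \<partial>lborel)"
    unfolding LT_def by (intro nn_integral_cong) (simp add: nn_integral_multc)
  also have "\<dots> = (\<integral>\<^sup>+t. (\<integral>\<^sup>+u. ennreal t * h t * ennreal (exp (- (u * t))) * indicator {0..} t
           * indicator {p<..<q} u \<partial>lborel) \<partial>lborel)"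
    by (rule lborel_pair.Fubini') measurable
  also have "\<dots> = (\<integral>\<^sup>+t. (\<integral>\<^sup>+u. (h t * indicator {0..} t) *
      (ennreal (t * exp (- (u * t))) * indicator {p<..<q} u) \<partial>lborel) \<partial>lborel)"
    by (intro nn_integral_cong) (auto simp: indicator_def ennreal_mult ac_simps)
  also have "\<dots> = (\<integral>\<^sup>+t. (h t * indicator {0..} t) *
      (\<integral>\<^sup>+u\<in>{p<..<q}. ennreal (t * exp (- (u * t))) \<partial>lborel) \<partial>lborel)"
    by (intro nn_integral_cong nn_integral_cmult) measurable
  finally have *: "(\<integral>\<^sup>+u\<in>{p<..<q}. LT (\<lambda>t. ennreal t * h t) u \<partial>lborel) = \<dots>" .
  have "LT h p = (\<integral>\<^sup>+t. h t * ennreal (exp (- (q * t))) * indicator {0..} t + (h t * indicator {0..} t) *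
      (\<integral>\<^sup>+u\<in>{p<..<q}. ennreal (t * exp (- (u * t))) \<partial>lborel) \<partial>lborel)"
    unfolding LT_def
    by (intro nn_integral_cong)
      (auto simp: indicator_def exp_difference_eq_nn_integral[OF assms(2)] distrib_left)
  also have "\<dots> = (\<integral>\<^sup>+t\<in>{0..}. h t * ennreal (exp (- (q * t))) \<partial>lborel) +
      (\<integral>\<^sup>+t. (h t * indicator {0..} t) *
        (\<integral>\<^sup>+u\<in>{p<..<q}. ennreal (t * exp (- (u * t))) \<partial>lborel) \<partial>lborel)"
    by (rule nn_integral_add) measurable
  finally have "LT h p = \<dots>" .
  then show ?thesis unfolding * LT_def[of h q] .
qed

text \<open>
  The transform of a primitive.
\<close>

lemma LT_nn_integral:
  assumes [measurable]: "h \<in> borel_measurable borel" and "0 < z"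
  shows "ennreal z * LT (\<lambda>t. \<integral>\<^sup>+r\<in>{0..t}. h r \<partial>lborel) z = LT h z"
proof -
  have "ennreal z * LT (\<lambda>t. \<integral>\<^sup>+r\<in>{0..t}. h r \<partial>lborel) z
      = (\<integral>\<^sup>+t. ennreal z * ((\<integral>\<^sup>+r. h r * (if 0 \<le> r \<and> r \<le> t then 1 else 0) \<partial>lborel) *
          ennreal (exp (- (z * t))) * indicator {0..} t) \<partial>lborel)"
    unfolding LT_def by (subst nn_integral_cmult) (simp_all add: indicator_def of_bool_def)
  also have "\<dots> = (\<integral>\<^sup>+t. (\<integral>\<^sup>+r. h r * (if 0 \<le> r \<and> r \<le> t then 1 else 0) *
          ennreal (z * exp (- (z * t))) \<partial>lborel) \<partial>lborel)"
  proof (rule nn_integral_cong)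
    fix t :: real
    show "ennreal z * ((\<integral>\<^sup>+r. h r * (if 0 \<le> r \<and> r \<le> t then 1 else 0) \<partial>lborel) *
          ennreal (exp (- (z * t))) * indicator {0..} t)
        = (\<integral>\<^sup>+r. h r * (if 0 \<le> r \<and> r \<le> t then 1 else 0) * ennreal (z * exp (- (z * t))) \<partial>lborel)"
    proof (cases "0 \<le> t")
      case True
      then show ?thesis using assms by (subst nn_integral_multc) (simp_all add: ennreal_mult ac_simps)
    next
      case False
      then have "(if 0 \<le> r \<and> r \<le> t then 1 else 0) = (0 :: ennreal)" for r by auto
      then show ?thesis using False by simp
    qed
  qed
  also have "\<dots> = (\<integral>\<^sup>+r. (\<integral>\<^sup>+t. h r * (if 0 \<le> r \<and> r \<le> t then 1 else 0) *
          ennreal (z * exp (- (z * t))) \<partial>lborel) \<partial>lborel)"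
    by (rule lborel_pair.Fubini') measurable
  also have "\<dots> = (\<integral>\<^sup>+r. h r * indicator {0..} r *
      (\<integral>\<^sup>+t\<in>{r..}. ennreal (z * exp (- (z * t))) \<partial>lborel) \<partial>lborel)"
    by (subst nn_integral_cmult[symmetric]) (auto intro!: nn_integral_cong simp: indicator_def)
  also have "\<dots> = LT h z"
    unfolding LT_def nn_integral_exp_tail[OF assms(2)] by (simp add: ac_simps)
  finally show ?thesis .
qed

section \<open>The solution of the adjoint equation\<close>

context parking_exponent
begin

text \<open>
  The adjoint solution \<open>y\<close>, its primitive \<open>Y\<close> and its derivative \<open>w\<close>, the latter two up to sign. In
  all three the argument is \<open>z = x - 1\<close>, the area less the longer base.
\<close>

definition Y :: "real \<Rightarrow> ennreal" where "Y = LT (\<lambda>t. ennreal (E t))"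

definition y :: "real \<Rightarrow> ennreal" where "y = LT (\<lambda>t. ennreal (t * E t))"

definition w :: "real \<Rightarrow> ennreal" where "w = LT (\<lambda>t. ennreal (t\<^sup>2 * E t))"

lemma measurable_y [measurable]: "y \<in> borel_measurable borel" and measurable_w [measurable]: "w \<in> borel_measurable borel"
  unfolding y_def w_def by measurable

lemma Y_difference: "p \<le> q \<Longrightarrow> Y p = Y q + (\<integral>\<^sup>+u\<in>{p<..<q}. y u \<partial>lborel)"
proof -
  have "LT (\<lambda>t. ennreal (t * E t)) = LT (\<lambda>t. ennreal t * ennreal (E t))"
    using E_pos by (intro ext LT_cong) (simp add: ennreal_mult less_imp_le)
  then show "p \<le> q \<Longrightarrow> Y p = Y q + (\<integral>\<^sup>+u\<in>{p<..<q}. y u \<partial>lborel)"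
    unfolding Y_def y_def by (simp add: LT_difference)
qed

lemma y_difference: "p \<le> q \<Longrightarrow> y p = y q + (\<integral>\<^sup>+u\<in>{p<..<q}. w u \<partial>lborel)"
proof -
  have "LT (\<lambda>t. ennreal (t\<^sup>2 * E t)) = LT (\<lambda>t. ennreal t * ennreal (t * E t))"
    using E_pos by (intro ext LT_cong) (simp add: power2_eq_square less_imp_le mult.assoc flip: ennreal_mult)
  then show "p \<le> q \<Longrightarrow> y p = y q + (\<integral>\<^sup>+u\<in>{p<..<q}. w u \<partial>lborel)"
    unfolding w_def y_def by (simp add: LT_difference)
qed

text \<open>
  The adjoint equation \<open>z * y'(z) = - y(z + 1) - y(z + \<gamma>)\<close>. It is an integration by parts: the factor
  \<open>z\<close> in front of the transform of \<open>t\<^sup>2 * E t\<close> passes to the derivative of that function.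
\<close>

lemma w_eq:
  assumes "0 < z"
  shows "ennreal z * w z = y (z + 1) + y (z + \<gamma>)"
proof -
  have "ennreal z * w z = ennreal z * LT (\<lambda>t. \<integral>\<^sup>+r\<in>{0..t}. ennreal (square_E_rate r) \<partial>lborel) z"
    unfolding w_def by (intro arg_cong2[where f=times] refl LT_cong square_E_eq)
  also have "\<dots> = LT (\<lambda>t. ennreal (square_E_rate t)) z" using assms by (intro LT_nn_integral) auto
  also have "\<dots> = LT (\<lambda>t. ennreal (exp (- (1 * t))) * ennreal (t * E t)
      + ennreal (exp (- (\<gamma> * t))) * ennreal (t * E t)) z"
    using E_pos by (intro LT_cong)
      (simp add: square_E_rate_def distrib_right less_imp_le mult.commute[of \<gamma>] flip: ennreal_mult ennreal_plus)
  also have "\<dots> = y (z + 1) + y (z + \<gamma>)"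
    unfolding y_def by (subst LT_add; (simp only: LT_exp_mult)?) measurable
  finally show ?thesis .
qed

text \<open>
  Since \<open>exp (- 2 * t) \<le> E t \<le> 1\<close>, the function \<open>y\<close> lies between two transforms of the identity.
\<close>

lemma y_le: "0 < z \<Longrightarrow> y z \<le> ennreal (1 / z\<^sup>2)"
  and y_ge: "0 < z \<Longrightarrow> ennreal (1 / (z + 2)\<^sup>2) \<le> y z"
proof -
  assume z: "0 < z"
  have "y z \<le> LT (\<lambda>t. ennreal t) z"
    unfolding y_def using E_le_1 by (intro LT_mono ennreal_leI) (simp add: mult_left_le)
  also have "LT (\<lambda>t. ennreal t) z = ennreal (1 / z\<^sup>2)"
    unfolding nn_integral_times_exp[OF z, symmetric] LT_def
    by (intro nn_integral_cong) (auto simp: indicator_def ennreal_mult)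
  finally show "y z \<le> ennreal (1 / z\<^sup>2)" .
  have "ennreal (1 / (z + 2)\<^sup>2) = LT (\<lambda>t. ennreal t) (z + 2)"
    using z unfolding LT_def
    by (subst nn_integral_times_exp[symmetric])
      (auto intro!: nn_integral_cong simp: indicator_def ennreal_mult)
  also have "\<dots> = LT (\<lambda>t. ennreal (exp (- (2 * t))) * ennreal t) z"
    by (simp add: LT_exp_mult)
  also have "\<dots> \<le> y z"
    unfolding y_def using E_bounds(1)
    by (intro LT_mono) (auto intro!: ennreal_leI mult_left_mono simp: mult.commute[of _ "_ :: real"] simp flip: ennreal_mult)
  finally show "ennreal (1 / (z + 2)\<^sup>2) \<le> y z" .
qed

lemma y_antimono: "p \<le> q \<Longrightarrow> y q \<le> y p"
  unfolding y_def by (rule LT_antimono)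

text \<open>
  The integral of \<open>square_E_rate\<close> over the half-line is at most \<open>1 + 1 / \<gamma>\<^sup>2 \<le> 5\<close>. This controls \<open>E\<close>
  at infinity.
\<close>

lemma square_E_le: "0 \<le> t \<Longrightarrow> t\<^sup>2 * E t \<le> 5"
proof -
  assume t: "0 \<le> t"
  have "ennreal (t\<^sup>2 * E t) \<le> (\<integral>\<^sup>+r. ennreal (r * exp (- (1 * r))) * indicator {0..} r
      + ennreal (r * exp (- (\<gamma> * r))) * indicator {0..} r \<partial>lborel)"
    unfolding square_E_eq[OF t]
  proof (rule nn_integral_mono)
    fix r :: real
    have "square_E_rate r \<le> r * exp (- (1 * r)) + r * exp (- (\<gamma> * r))" if "0 \<le> r"
      using that E_le_1[of r] E_pos[of r]
      mult_left_mono[of "E r" 1 "(exp (- r) + exp (- (r * \<gamma>))) * r"]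
      by (simp add: square_E_rate_def algebra_simps)
    then show "ennreal (square_E_rate r) * indicator {0..t} r \<le> ennreal (r * exp (- (1 * r))) * indicator {0..} r
      + ennreal (r * exp (- (\<gamma> * r))) * indicator {0..} r"
      by (auto simp: indicator_def simp flip: ennreal_plus intro!: ennreal_leI)
  qed
  also have "\<dots> = ennreal (1 / 1\<^sup>2) + ennreal (1 / \<gamma>\<^sup>2)"
    using \<gamma>_ge by (subst nn_integral_add) (simp_all only: nn_integral_times_exp, auto)
  also have "\<dots> \<le> ennreal 5"
  proof -
    have "(1/2)\<^sup>2 \<le> \<gamma>\<^sup>2" using \<gamma>_ge by (intro power_mono) auto
    then have "1 + 1 / \<gamma>\<^sup>2 \<le> 5" using \<gamma>_ge by (simp add: field_simps power2_eq_square)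
    then have "ennreal (1 / 1\<^sup>2 + 1 / \<gamma>\<^sup>2) \<le> ennreal 5" by (intro ennreal_leI) simp
    then show ?thesis by (subst ennreal_plus[symmetric]) auto
  qed
  finally show "t\<^sup>2 * E t \<le> 5" by (subst (asm) ennreal_le_iff) auto
qed

end

section \<open>A conserved quantity of the delay equation\<close>

text \<open>
  The delay equation with longer base \<open>1\<close>, in the integrated form
  \<open>z * f (z + 1) = \<integral> (f u + f (u + 1 - \<gamma>)) du\<close> over \<open>0 < u < z\<close>. Its right-hand side vanishes at \<open>z = 0\<close>,
  so no integration constant occurs. The constant \<open>K\<close> witnesses that \<open>f\<close> grows at most linearly.
\<close>

locale parking_delay_equation = parking_exponent +
  fixes f :: "real \<Rightarrow> ennreal" and K :: real
  assumes f_measurable [measurable]: "f \<in> borel_measurable borel"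
    and f_initial: "\<And>u. 0 < u \<Longrightarrow> u < \<gamma> \<Longrightarrow> f u = 2"
    and f_between: "\<And>u. \<gamma> \<le> u \<Longrightarrow> u < 1 \<Longrightarrow> f u = 3"
    and K_nonneg: "0 \<le> K"
    and f_le: "\<And>u. 0 \<le> u \<Longrightarrow> f u \<le> ennreal (K * u + 2)"
    and delay: "\<And>z. 0 < z \<Longrightarrow>
      ennreal z * f (z + 1) = (\<integral>\<^sup>+u\<in>{0<..<z}. f u + f (u + (1 - \<gamma>)) \<partial>lborel)"
begin

definition \<delta> :: real where "\<delta> = 1 - \<gamma>"

lemmas f_delay = delay[folded \<delta>_def]

lemma \<delta>_nonneg: "0 \<le> \<delta>" and \<delta>_le_\<gamma>: "\<delta> \<le> \<gamma>" and \<delta>_le: "\<delta> \<le> 1 / 2"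
  using \<gamma>_ge \<gamma>_le by (auto simp: \<delta>_def)

text \<open>
  The delay equation is multiplied by \<open>y\<close> and integrated by parts: \<open>y v\<close> is replaced by
  \<open>y z + \<integral> w\<close> over \<open>v < u < z\<close>, the order of integration is exchanged, and then the adjoint equation
  for \<open>w\<close> applies. In this form no boundary term at \<open>0\<close>, where \<open>y\<close> is unbounded, has to be discussed.
\<close>

lemma adjoint_identity:
  assumes "0 < z"
  shows "(\<integral>\<^sup>+v\<in>{0<..<z}. (f v + f (v + \<delta>)) * y v \<partial>lborel)
    = ennreal z * f (z + 1) * y z + (\<integral>\<^sup>+u\<in>{0<..<z}. f (u + 1) * (y (u + 1) + y (u + \<gamma>)) \<partial>lborel)"
proof -
  define \<phi> where "\<phi> v = f v + f (v + \<delta>)" for v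
  have [measurable]: "\<phi> \<in> borel_measurable borel" unfolding \<phi>_def by measurable
  have "(\<integral>\<^sup>+v\<in>{0<..<z}. \<phi> v * y v \<partial>lborel)
      = (\<integral>\<^sup>+v. \<phi> v * indicator {0<..<z} v * y z +
          (\<integral>\<^sup>+u. \<phi> v * w u * (if 0 < v \<and> v < u \<and> u < z then 1 else 0) \<partial>lborel) \<partial>lborel)"
  proof (rule nn_integral_cong)
    fix v :: real
    show "\<phi> v * y v * indicator {0<..<z} v = \<phi> v * indicator {0<..<z} v * y z +
          (\<integral>\<^sup>+u. \<phi> v * w u * (if 0 < v \<and> v < u \<and> u < z then 1 else 0) \<partial>lborel)"
    proof (cases "0 < v \<and> v < z")
      case True
      have "(\<integral>\<^sup>+u. \<phi> v * w u * (if 0 < v \<and> v < u \<and> u < z then 1 else 0) \<partial>lborel)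
          = (\<integral>\<^sup>+u. \<phi> v * (w u * indicator {v<..<z} u) \<partial>lborel)"
        using True by (intro nn_integral_cong) (auto simp: indicator_def)
      then show ?thesis
        using True by (simp add: y_difference[of v z] distrib_left nn_integral_cmult)
    next
      case False
      then have "(if 0 < v \<and> v < u \<and> u < z then 1 else 0) = (0 :: ennreal)" for u by auto
      then show ?thesis using False by (auto simp: indicator_def)
    qed
  qed
  also have "\<dots> = (\<integral>\<^sup>+v. \<phi> v * indicator {0<..<z} v * y z \<partial>lborel) +
      (\<integral>\<^sup>+v. (\<integral>\<^sup>+u. \<phi> v * w u * (if 0 < v \<and> v < u \<and> u < z then 1 else 0) \<partial>lborel) \<partial>lborel)"
    by (rule nn_integral_add) measurable
  also have "(\<integral>\<^sup>+v. \<phi> v * indicator {0<..<z} v * y z \<partial>lborel) = ennreal z * f (z + 1) * y z"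
    unfolding f_delay[OF assms] \<phi>_def[symmetric] by (rule nn_integral_multc) measurable
  also have "(\<integral>\<^sup>+v. (\<integral>\<^sup>+u. \<phi> v * w u * (if 0 < v \<and> v < u \<and> u < z then 1 else 0) \<partial>lborel) \<partial>lborel)
      = (\<integral>\<^sup>+u. (\<integral>\<^sup>+v. \<phi> v * w u * (if 0 < v \<and> v < u \<and> u < z then 1 else 0) \<partial>lborel) \<partial>lborel)"
    by (rule lborel_pair.Fubini') measurable
  also have "\<dots> = (\<integral>\<^sup>+u\<in>{0<..<z}. f (u + 1) * (y (u + 1) + y (u + \<gamma>)) \<partial>lborel)"
  proof (rule nn_integral_cong)
    fix u :: real
    show "(\<integral>\<^sup>+v. \<phi> v * w u * (if 0 < v \<and> v < u \<and> u < z then 1 else 0) \<partial>lborel)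
        = f (u + 1) * (y (u + 1) + y (u + \<gamma>)) * indicator {0<..<z} u"
    proof (cases "0 < u \<and> u < z")
      case True
      have "(\<integral>\<^sup>+v. \<phi> v * w u * (if 0 < v \<and> v < u \<and> u < z then 1 else 0) \<partial>lborel)
          = (\<integral>\<^sup>+v. (\<phi> v * indicator {0<..<u} v) * w u \<partial>lborel)"
        using True by (intro nn_integral_cong) (auto simp: indicator_def)
      also have "\<dots> = ennreal u * f (u + 1) * w u"
        using True unfolding \<phi>_def by (subst f_delay) (simp_all add: nn_integral_multc)
      also have "\<dots> = f (u + 1) * (ennreal u * w u)" by (simp add: ac_simps)
      finally show ?thesis using True by (simp add: w_eq)
    next
      case False
      then have "(if 0 < v \<and> v < u \<and> u < z then 1 else 0) = (0 :: ennreal)" for v by auto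
      then show ?thesis using False by (auto simp: indicator_def)
    qed
  qed
  finally show ?thesis unfolding \<phi>_def .
qed

text \<open>
  The limit at \<open>z = 0\<close> of the conserved quantity below.
\<close>

definition conserved_value where "conserved_value = (\<integral>\<^sup>+v\<in>{0<..<1}. f v * y v \<partial>lborel) + (\<integral>\<^sup>+v\<in>{\<delta><..<1}. f v * y (v - \<delta>) \<partial>lborel)"

text \<open>
  The part of the conserved quantity that vanishes at infinity; \<open>v - \<delta>\<close> is \<open>v + \<gamma> - 1\<close>.
\<close>

definition remainder where "remainder z = (\<integral>\<^sup>+v\<in>{z<..<z + 1}. f v * y v \<partial>lborel) +
   (\<integral>\<^sup>+v\<in>{z + \<delta><..<z + 1}. f v * y (v - \<delta>) \<partial>lborel)"

lemma y_finite: "0 < z \<Longrightarrow> y z < \<top>"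
  using y_le[of z] by (auto simp: less_top[symmetric] top_unique)

lemma nn_integral_f_y_le:
  assumes "0 \<le> p" "p \<le> q" "0 < s" and g: "\<And>v. p < v \<Longrightarrow> v < q \<Longrightarrow> s \<le> g v"
  shows "(\<integral>\<^sup>+v\<in>{p<..<q}. f v * y (g v) \<partial>lborel) \<le> ennreal ((K * q + 2) * (q - p)) * y s"
proof -
  have "(\<integral>\<^sup>+v\<in>{p<..<q}. f v * y (g v) \<partial>lborel) \<le> (\<integral>\<^sup>+v\<in>{p<..<q}. ennreal (K * q + 2) * y s \<partial>lborel)"
  proof (rule nn_integral_mono)
    fix v
    have "f v \<le> ennreal (K * q + 2)" if "p < v" "v < q"
      using that assms(1) K_nonneg by (intro order_trans[OF f_le] ennreal_leI) (auto intro: mult_left_mono)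
    then show "f v * y (g v) * indicator {p<..<q} v \<le> ennreal (K * q + 2) * y s * indicator {p<..<q} v"
      using g[of v] by (auto simp: indicator_def intro!: mult_mono y_antimono)
  qed
  also have "\<dots> = ennreal (K * q + 2) * y s * ennreal (q - p)"
    by (rule nn_integral_interval_const)
  also have "\<dots> = ennreal ((K * q + 2) * (q - p)) * y s"
    using assms K_nonneg by (subst ennreal_mult) (simp_all only: ac_simps, auto)
  finally show ?thesis .
qed

text \<open>
  The integrals over the common parts of the domains cancel on the two sides of
  \<open>adjoint_identity\<close>; they are finite because \<open>y\<close> is bounded on \<open>{\<gamma>..}\<close>.
\<close>

lemma conserved:
  assumes "1 \<le> z"
  shows "conserved_value = ennreal z * f (z + 1) * y z + remainder z"
proof -
  define U where "U = (\<integral>\<^sup>+v\<in>{1<..<z}. f v * y v \<partial>lborel)"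
  define V where "V = (\<integral>\<^sup>+v\<in>{1<..<z + \<delta>}. f v * y (v - \<delta>) \<partial>lborel)"
  have "U \<le> ennreal ((K * z + 2) * (z - 1)) * y 1"
    unfolding U_def using assms by (intro nn_integral_f_y_le) auto
  moreover have "V \<le> ennreal ((K * (z + \<delta>) + 2) * (z + \<delta> - 1)) * y (1 - \<delta>)"
    unfolding V_def using assms \<delta>_nonneg \<delta>_le by (intro nn_integral_f_y_le) auto
  ultimately have fin: "U < \<top>" "V < \<top>"
    using y_finite[of 1] y_finite[of "1 - \<delta>"] \<delta>_le
    by (auto simp: ennreal_mult_less_top elim!: order.strict_trans1)
  have "(\<integral>\<^sup>+v\<in>{0<..<z}. (f v + f (v + \<delta>)) * y v \<partial>lborel)
      = (\<integral>\<^sup>+v\<in>{0<..<z}. f v * y v \<partial>lborel) + (\<integral>\<^sup>+v\<in>{0<..<z}. f (v + \<delta>) * y v \<partial>lborel)"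
    by (subst nn_integral_interval_add[symmetric]) (simp_all add: distrib_right)
  also have "(\<integral>\<^sup>+v\<in>{0<..<z}. f (v + \<delta>) * y v \<partial>lborel) = (\<integral>\<^sup>+v\<in>{\<delta><..<z + \<delta>}. f v * y (v - \<delta>) \<partial>lborel)"
    using nn_integral_interval_shift[where g= "\<lambda>v. f (v + \<delta>) * y v" and p=\<delta> and q="z + \<delta>" and s=\<delta>] by simp
  also have "\<dots> = (\<integral>\<^sup>+v\<in>{\<delta><..<1}. f v * y (v - \<delta>) \<partial>lborel) + V"
    unfolding V_def using assms \<delta>_nonneg \<delta>_le by (intro nn_integral_interval_split) auto
  also have "(\<integral>\<^sup>+v\<in>{0<..<z}. f v * y v \<partial>lborel) = (\<integral>\<^sup>+v\<in>{0<..<1}. f v * y v \<partial>lborel) + U"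
    unfolding U_def using assms by (intro nn_integral_interval_split) auto
  finally have left: "(\<integral>\<^sup>+v\<in>{0<..<z}. (f v + f (v + \<delta>)) * y v \<partial>lborel) = (U + V) + conserved_value"
    by (simp add: conserved_value_def add_ac)
  have "(\<integral>\<^sup>+u\<in>{0<..<z}. f (u + 1) * (y (u + 1) + y (u + \<gamma>)) \<partial>lborel)
      = (\<integral>\<^sup>+u\<in>{0<..<z}. f (u + 1) * y (u + 1) \<partial>lborel) + (\<integral>\<^sup>+u\<in>{0<..<z}. f (u + 1) * y (u + \<gamma>) \<partial>lborel)"
    by (subst nn_integral_interval_add[symmetric]) (simp_all add: distrib_left)
  also have "(\<integral>\<^sup>+u\<in>{0<..<z}. f (u + 1) * y (u + 1) \<partial>lborel) = (\<integral>\<^sup>+v\<in>{1<..<z + 1}. f v * y v \<partial>lborel)"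
    using nn_integral_interval_shift[where g= "\<lambda>u. f (u + 1) * y (u + 1)" and p=1 and q="z + 1" and s=1] by simp
  also have "\<dots> = U + (\<integral>\<^sup>+v\<in>{z<..<z + 1}. f v * y v \<partial>lborel)"
    unfolding U_def using assms by (intro nn_integral_interval_split) auto
  also have "(\<integral>\<^sup>+u\<in>{0<..<z}. f (u + 1) * y (u + \<gamma>) \<partial>lborel) = (\<integral>\<^sup>+v\<in>{1<..<z + 1}. f v * y (v - \<delta>) \<partial>lborel)"
    using nn_integral_interval_shift[where g= "\<lambda>u. f (u + 1) * y (u + \<gamma>)" and p=1 and q="z + 1" and s=1] by (simp add: \<delta>_def algebra_simps)
  also have "\<dots> = V + (\<integral>\<^sup>+v\<in>{z + \<delta><..<z + 1}. f v * y (v - \<delta>) \<partial>lborel)"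
    unfolding V_def using assms \<delta>_nonneg \<delta>_le by (intro nn_integral_interval_split) auto
  finally have right: "(\<integral>\<^sup>+u\<in>{0<..<z}. f (u + 1) * (y (u + 1) + y (u + \<gamma>)) \<partial>lborel) = (U + V) + remainder z"
    by (simp add: remainder_def add_ac)
  (* Finiteness of U and V is what permits the cancellation. *)
  have "(U + V) + conserved_value = (U + V) + (ennreal z * f (z + 1) * y z + remainder z)"
    using adjoint_identity[of z] assms unfolding left right by (simp add: add_ac)
  then show ?thesis using fin by (subst (asm) ennreal_add_left_cancel) auto
qed

lemma remainder_le:
  assumes "1 \<le> z"
  shows "remainder z \<le> ennreal (2 * (K * (z + 1) + 2) / z\<^sup>2)"
proof -
  have "remainder z \<le> ennreal ((K * (z + 1) + 2) * (z + 1 - z)) * y z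
      + ennreal ((K * (z + 1) + 2) * (z + 1 - (z + \<delta>))) * y z"
    unfolding remainder_def using assms \<delta>_nonneg \<delta>_le by (intro add_mono nn_integral_f_y_le) auto
  also have "\<dots> \<le> ennreal (K * (z + 1) + 2) * ennreal (1 / z\<^sup>2) + ennreal (K * (z + 1) + 2) * ennreal (1 / z\<^sup>2)"
    using assms \<delta>_nonneg K_nonneg by (intro add_mono mult_mono y_le ennreal_leI mult_left_le) auto
  also have "\<dots> = ennreal (2 * (K * (z + 1) + 2) / z\<^sup>2)"
    using assms K_nonneg by (simp flip: ennreal_mult ennreal_plus)
  finally show ?thesis .
qed

text \<open>
  The factor \<open>z * (z + 1) * y z\<close> tends to \<open>1\<close> and the remainder to \<open>0\<close>, so the conserved quantity is
  asymptotic to \<open>f (z + 1) / (z + 1)\<close>.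
\<close>

lemma tendsto_conserved_value:
  "((\<lambda>x. enn2real (f x) / x) \<longlongrightarrow> enn2real conserved_value) at_top"
proof -
  define g where "g z = enn2real (f (z + 1))" for z
  define yr where "yr z = enn2real (y z)" for z
  define r where "r z = enn2real (remainder z)" for z
  have eq: "enn2real conserved_value = z * g z * yr z + r z" if "1 \<le> z" for z
  proof -
    have "f (z + 1) < \<top>" using that f_le[of "z + 1"] by (auto simp: less_top[symmetric] top_unique)
    moreover have "remainder z < \<top>" using remainder_le[OF that] by (auto simp: less_top[symmetric] top_unique)
    ultimately show ?thesis
      using that y_finite[of z] unfolding conserved[OF that] g_def yr_def r_def
      by (subst enn2real_plus) (auto simp: ennreal_mult_less_top enn2real_mult)
  qed
  have r: "(r \<longlongrightarrow> 0) at_top"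
  proof (rule tendsto_sandwich[where f="\<lambda>_. 0"])
    show "((\<lambda>z. 2 * (K * (z + 1) + 2) / z\<^sup>2) \<longlongrightarrow> 0) at_top" by real_asymp
    show "\<forall>\<^sub>F z in at_top. r z \<le> 2 * (K * (z + 1) + 2) / z\<^sup>2"
      using eventually_ge_at_top[of 1]
    proof eventually_elim
      case (elim z)
      then show ?case using enn2real_mono[OF remainder_le[of z]] K_nonneg by (simp add: r_def)
    qed
    show "((\<lambda>_. 0) \<longlongrightarrow> (0 :: real)) (at_top :: real filter)" by simp
    show "\<forall>\<^sub>F z in at_top. 0 \<le> r z" by (simp add: r_def)
  qed
  have yr_bounds: "1 / (z + 2)\<^sup>2 \<le> yr z" "yr z \<le> 1 / z\<^sup>2" if "1 \<le> z" for z
    using enn2real_mono[OF y_le[of z]] enn2real_mono[OF y_ge[of z]] y_finite[of z] that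
    by (auto simp: yr_def)
  have yr_lim: "((\<lambda>z. z * (z + 1) * yr z) \<longlongrightarrow> 1) at_top"
  proof (rule tendsto_sandwich)
    show "((\<lambda>z::real. z * (z + 1) * (1 / (z + 2)\<^sup>2)) \<longlongrightarrow> 1) at_top" by real_asymp
    show "((\<lambda>z::real. z * (z + 1) * (1 / z\<^sup>2)) \<longlongrightarrow> 1) at_top" by real_asymp
    show "\<forall>\<^sub>F z in at_top. z * (z + 1) * (1 / (z + 2)\<^sup>2) \<le> z * (z + 1) * yr z"
      using eventually_ge_at_top[of 1]
      by eventually_elim (rule mult_left_mono[OF yr_bounds(1)], simp_all)
    show "\<forall>\<^sub>F z in at_top. z * (z + 1) * yr z \<le> z * (z + 1) * (1 / z\<^sup>2)"
      using eventually_ge_at_top[of 1]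
      by eventually_elim (rule mult_left_mono[OF yr_bounds(2)], simp_all)
  qed
  have "((\<lambda>z. (enn2real conserved_value - r z) / (z * (z + 1) * yr z)) \<longlongrightarrow> (enn2real conserved_value - 0) / 1) at_top"
    by (intro tendsto_intros r yr_lim) simp
  moreover have "\<forall>\<^sub>F z in at_top. (enn2real conserved_value - r z) / (z * (z + 1) * yr z) = g z / (z + 1)"
    using eventually_ge_at_top[of 1]
  proof eventually_elim
    case (elim z)
    have "0 < 1 / (z + 2)\<^sup>2" using elim by simp
    then have "0 < yr z" using yr_bounds(1)[OF elim] by linarith
    then have "z * yr z \<noteq> 0" using elim by simp
    then have "(z * yr z * g z) / (z * yr z * (z + 1)) = g z / (z + 1)"
      by (rule mult_divide_mult_cancel_left)
    then show ?case by (simp add: eq[OF elim] ac_simps)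
  qed
  ultimately have "((\<lambda>z. g z / (z + 1)) \<longlongrightarrow> enn2real conserved_value) at_top"
    using tendsto_cong by force
  moreover have "filterlim (\<lambda>x::real. x - 1) at_top at_top" by real_asymp
  ultimately have "((\<lambda>x. g (x - 1) / (x - 1 + 1)) \<longlongrightarrow> enn2real conserved_value) at_top"
    by (rule filterlim_compose)
  then show ?thesis by (simp add: g_def)
qed

end

section \<open>Evaluation of the conserved quantity\<close>

context parking_exponent
begin

lemma nn_integral_E_finite: "(\<integral>\<^sup>+t\<in>{0..}. ennreal (E t) \<partial>lborel) < \<top>"
proof -
  have "(\<integral>\<^sup>+t\<in>{0..}. ennreal (E t) \<partial>lborel)
      \<le> (\<integral>\<^sup>+t. indicator {0..1} t + ennreal (5 / t\<^sup>2) * indicator {1..} t \<partial>lborel)"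
  proof (rule nn_integral_mono)
    fix t :: real
    consider "t < 0" | "0 \<le> t" "t \<le> 1" | "1 < t" by linarith
    then show "ennreal (E t) * indicator {0..} t \<le> indicator {0..1} t + ennreal (5 / t\<^sup>2) * indicator {1..} t"
    proof cases
      case 2
      then have "ennreal (E t) * indicator {0..} t \<le> 1" using E_le_1[of t] by simp
      also have "1 \<le> indicator {0..1} t + X" for X :: ennreal using 2 by simp
      finally show ?thesis .
    next
      case 3
      then show ?thesis using square_E_le[of t] by (auto simp: field_simps intro!: ennreal_leI)
    qed simp
  qed
  also have "\<dots> = 1 + (\<integral>\<^sup>+t. ennreal (5 / t\<^sup>2) * indicator {1..} t \<partial>lborel)"
    by (subst nn_integral_add) auto
  also have "(\<integral>\<^sup>+t. ennreal (5 / t\<^sup>2) * indicator {1..} t \<partial>lborel) = ennreal (0 - - 5 / 1)"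
  proof (rule nn_integral_FTC_atLeast)
    show "((\<lambda>t::real. - 5 / t) \<longlongrightarrow> 0) at_top" by real_asymp
  qed (auto intro!: derivative_eq_intros simp: power2_eq_square)
  finally show ?thesis by (auto simp: less_top[symmetric] top_unique)
qed

lemma Y_finite: "0 \<le> z \<Longrightarrow> Y z < \<top>"
proof -
  assume "0 \<le> z"
  then have "Y z \<le> Y 0" unfolding Y_def by (rule LT_antimono)
  also have "Y 0 < \<top>" using nn_integral_E_finite by (simp add: Y_def LT_def)
  finally show "Y z < \<top>" .
qed

text \<open>
  The real-valued version of \<open>Y\<close>, meaningful for \<open>z \<ge> 0\<close>.
\<close>

definition Yr where "Yr z = (LBINT t:{0..}. exp (- (z * t)) * E t)"

lemma set_integrable_E: "0 \<le> z \<Longrightarrow> set_integrable lborel {0..} (\<lambda>t. exp (- (z * t)) * E t)"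
  unfolding set_integrable_def
proof (rule integrableI_nonneg)
  assume "0 \<le> z"
  have "(\<integral>\<^sup>+t. ennreal (indicator {0..} t *\<^sub>R (exp (- (z * t)) * E t)) \<partial>lborel) = Y z"
    unfolding Y_def LT_def using E_pos
    by (intro nn_integral_cong) (auto simp: indicator_def less_imp_le mult.commute simp flip: ennreal_mult)
  then show "(\<integral>\<^sup>+t. ennreal (indicator {0..} t *\<^sub>R (exp (- (z * t)) * E t)) \<partial>lborel) < \<infinity>"
    using Y_finite[OF \<open>0 \<le> z\<close>] by simp
qed (use E_pos in \<open>auto simp: less_imp_le\<close>)

lemma Y_eq: "0 \<le> z \<Longrightarrow> Y z = ennreal (Yr z)"
proof -
  assume "0 \<le> z"
  have "Y z = (\<integral>\<^sup>+t. ennreal (indicator {0..} t *\<^sub>R (exp (- (z * t)) * E t)) \<partial>lborel)"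
    unfolding Y_def LT_def using E_pos
    by (intro nn_integral_cong) (auto simp: indicator_def less_imp_le mult.commute simp flip: ennreal_mult)
  also have "\<dots> = ennreal (Yr z)"
    unfolding Yr_def set_lebesgue_integral_def
    using set_integrable_E[OF \<open>0 \<le> z\<close>] E_pos
    by (intro nn_integral_eq_integral) (auto simp: set_integrable_def less_imp_le)
  finally show ?thesis .
qed

lemma Yr_nonneg: "0 \<le> Yr z"
  unfolding Yr_def set_lebesgue_integral_def using E_pos
  by (intro integral_nonneg_AE AE_I2) (auto simp: less_imp_le)

lemma nn_integral_y:
  assumes "0 \<le> p" "p \<le> q"
  shows "(\<integral>\<^sup>+u\<in>{p<..<q}. y u \<partial>lborel) = ennreal (Yr p - Yr q)"
proof -
  define J where "J = (\<integral>\<^sup>+u\<in>{p<..<q}. y u \<partial>lborel)"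
  have "ennreal (Yr p) = ennreal (Yr q) + J"
    using Y_difference[of p q] assms by (simp add: Y_eq J_def)
  then have "J = ennreal (Yr p) - ennreal (Yr q)"
    by (simp add: ennreal_add_diff_cancel_left)
  then show ?thesis by (simp add: J_def ennreal_minus Yr_nonneg)
qed

lemma Yr_antimono: "0 \<le> p \<Longrightarrow> p \<le> q \<Longrightarrow> Yr q \<le> Yr p"
  using Y_eq[of p] Y_eq[of q] LT_antimono[of p q "\<lambda>t. ennreal (E t)"] Yr_nonneg
  by (auto simp: Y_def ennreal_le_iff)

text \<open>
  The integral of \<open>(t * E t)'\<close> over the half-line vanishes, because \<open>t * E t\<close> tends to \<open>0\<close> at both ends.
\<close>

lemma Yr_identity: "Yr 0 = Yr 1 + Yr \<gamma>"
proof -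
  let ?g = "\<lambda>t. (- 1 + exp (- t) + exp (- (t * \<gamma>))) * E t"
  have int: "set_integrable lborel {0..} ?g"
    using set_integral_add(1)[OF set_integral_diff(1)[OF set_integrable_E[of 1] set_integrable_E[of 0]]
        set_integrable_E[of \<gamma>]] \<gamma>_ge
    by (simp add: algebra_simps)
  have lim: "((\<lambda>t. t * E t) \<longlongrightarrow> 0) at_top"
  proof (rule tendsto_sandwich[where f="\<lambda>_. 0"])
    show "((\<lambda>t::real. 5 / t) \<longlongrightarrow> 0) at_top" by real_asymp
    show "\<forall>\<^sub>F t in at_top. t * E t \<le> 5 / t"
      using eventually_gt_at_top[of 0]
    proof eventually_elim
      case (elim t)
      then show ?case using square_E_le[of t] by (simp add: field_simps power2_eq_square)
    qed
    show "\<forall>\<^sub>F t in at_top. 0 \<le> t * E t"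
      using eventually_gt_at_top[of 0] by eventually_elim (simp add: E_pos less_imp_le)
  qed simp
  have lim0: "((\<lambda>t. t * E t) \<longlongrightarrow> 0) (at_right 0)"
  proof -
    have "isCont (\<lambda>t. t * E t) 0" by (intro continuous_intros E_isCont)
    then show ?thesis by (auto simp: isCont_def intro: tendsto_mono[OF at_le])
  qed
  have "(LBINT t=0..\<infinity>. ?g t) = 0 - 0"
  proof (rule interval_integral_FTC_integrable[where F="\<lambda>t. t * E t"])
    show "set_integrable lborel (einterval 0 \<infinity>) ?g"
      by (rule set_integrable_subset[OF int]) (auto simp: einterval_def)
    show "(((\<lambda>t. t * E t) \<circ> real_of_ereal) \<longlongrightarrow> 0) (at_right 0)"
      using lim0 by (simp add: ereal_tendsto_simps zero_ereal_def)
    show "(((\<lambda>t. t * E t) \<circ> real_of_ereal) \<longlongrightarrow> 0) (at_left \<infinity>)"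
      using lim by (simp add: ereal_tendsto_simps)
  next
    fix t assume "0 < ereal t" "ereal t < \<infinity>"
    then show "((\<lambda>t. t * E t) has_vector_derivative ?g t) (at t)"
      using E_times_has_derivative[of t] by (simp add: has_real_derivative_iff_has_vector_derivative)
    show "isCont ?g t" by (intro continuous_intros E_isCont)
  qed simp
  then have "(LBINT t:{0<..}. ?g t) = 0"
    by (simp add: interval_lebesgue_integral_0_infty)
  moreover have "(LBINT t:{0<..}. ?g t) = (LBINT t:{0..}. ?g t)"
  proof -
    have "AE t in lborel. indicator {0<..} t *\<^sub>R ?g t = indicator {0..} t *\<^sub>R ?g t"
      using AE_lborel_singleton[of "0::real"] by (rule eventually_mono) (auto simp: indicator_def)
    then show ?thesis unfolding set_lebesgue_integral_def by (intro integral_cong_AE) simp_all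
  qed
  moreover have "(LBINT t:{0..}. ?g t) = Yr 1 - Yr 0 + Yr \<gamma>"
    unfolding Yr_def
    using set_integral_add(2)[OF set_integral_diff(1)[OF set_integrable_E[of 1] set_integrable_E[of 0]]
        set_integrable_E[of \<gamma>]] set_integral_diff(2)[OF set_integrable_E[of 1] set_integrable_E[of 0]] \<gamma>_ge
    by (simp add: algebra_simps)
  ultimately show ?thesis by simp
qed

end

context parking_delay_equation
begin

text \<open>
  The function \<open>f\<close> is \<open>2\<close> below \<open>\<gamma>\<close> and \<open>3\<close> from \<open>\<gamma>\<close> to \<open>1\<close>, which gives
  \<open>4 * Yr 0 - 2 * Yr \<gamma> - 3 * Yr 1 + Yr (2 * \<gamma> - 1)\<close>; subtracting twice the identity
  \<open>Yr_identity\<close> brings it into the stated form.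
\<close>

lemma conserved_value_eq: "conserved_value = ennreal (2 * Yr 0 - Yr 1 + Yr (2 * \<gamma> - 1))"
proof -
  note pos = \<delta>_nonneg \<delta>_le \<delta>_le_\<gamma> \<gamma>_ge \<gamma>_le
  have f_piece: "(\<integral>\<^sup>+u\<in>{p<..<q}. f (u + s) * y u \<partial>lborel) = ennreal (C * (Yr p - Yr q))"
    if "0 \<le> p" "p \<le> q" "0 \<le> C" "\<And>u. p < u \<Longrightarrow> u < q \<Longrightarrow> f (u + s) = ennreal C" for p q s C
  proof -
    have "(\<integral>\<^sup>+u\<in>{p<..<q}. f (u + s) * y u \<partial>lborel) = (\<integral>\<^sup>+u. ennreal C * (y u * indicator {p<..<q} u) \<partial>lborel)"
      using that by (intro nn_integral_cong) (auto simp: indicator_def)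
    also have "\<dots> = ennreal (C * (Yr p - Yr q))"
      using that by (simp add: nn_integral_cmult nn_integral_y ennreal_mult Yr_antimono)
    finally show ?thesis .
  qed
  have "(\<integral>\<^sup>+v\<in>{0<..<1}. f v * y v \<partial>lborel)
      = (\<integral>\<^sup>+v\<in>{0<..<\<gamma>}. f (v + 0) * y v \<partial>lborel) + (\<integral>\<^sup>+v\<in>{\<gamma><..<1}. f (v + 0) * y v \<partial>lborel)"
    using pos by (simp add: nn_integral_interval_split[of _ 0 \<gamma> 1])
  also have "\<dots> = ennreal (2 * (Yr 0 - Yr \<gamma>)) + ennreal (3 * (Yr \<gamma> - Yr 1))"
    using pos by (intro arg_cong2[where f=plus] f_piece) (auto simp: f_initial f_between)
  finally have 1: "(\<integral>\<^sup>+v\<in>{0<..<1}. f v * y v \<partial>lborel) = \<dots>" .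
  have "(\<integral>\<^sup>+v\<in>{\<delta><..<1}. f v * y (v - \<delta>) \<partial>lborel) = (\<integral>\<^sup>+u\<in>{0<..<\<gamma>}. f (u + \<delta>) * y u \<partial>lborel)"
    using nn_integral_interval_shift[where g="\<lambda>v. f (v + \<delta>) * y v" and p=\<delta> and q=1 and s=\<delta>]
    by (simp add: \<delta>_def)
  also have "\<dots> = (\<integral>\<^sup>+u\<in>{0<..<2 * \<gamma> - 1}. f (u + \<delta>) * y u \<partial>lborel)
      + (\<integral>\<^sup>+u\<in>{2 * \<gamma> - 1<..<\<gamma>}. f (u + \<delta>) * y u \<partial>lborel)"
    using pos by (intro nn_integral_interval_split) auto
  also have "\<dots> = ennreal (2 * (Yr 0 - Yr (2 * \<gamma> - 1))) + ennreal (3 * (Yr (2 * \<gamma> - 1) - Yr \<gamma>))"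
    using pos by (intro arg_cong2[where f=plus] f_piece) (auto simp: \<delta>_def f_initial f_between)
  finally have 2: "(\<integral>\<^sup>+v\<in>{\<delta><..<1}. f v * y (v - \<delta>) \<partial>lborel) = \<dots>" .
  have mono: "Yr \<gamma> \<le> Yr 0" "Yr 1 \<le> Yr \<gamma>" "Yr (2 * \<gamma> - 1) \<le> Yr 0" "Yr \<gamma> \<le> Yr (2 * \<gamma> - 1)"
    using pos by (auto intro!: Yr_antimono)
  have "conserved_value = ennreal (2 * (Yr 0 - Yr \<gamma>) + 3 * (Yr \<gamma> - Yr 1)
      + (2 * (Yr 0 - Yr (2 * \<gamma> - 1)) + 3 * (Yr (2 * \<gamma> - 1) - Yr \<gamma>)))"
    unfolding conserved_value_def 1 2 using mono by (simp flip: ennreal_plus)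
  also have "2 * (Yr 0 - Yr \<gamma>) + 3 * (Yr \<gamma> - Yr 1)
      + (2 * (Yr 0 - Yr (2 * \<gamma> - 1)) + 3 * (Yr (2 * \<gamma> - 1) - Yr \<gamma>))
      = 2 * Yr 0 - Yr 1 + Yr (2 * \<gamma> - 1)"
    using Yr_identity by (simp add: algebra_simps)
  finally show ?thesis .
qed

lemma tendsto_ratio:
  "((\<lambda>x. enn2real (f x) / x) \<longlongrightarrow>
     (LBINT t:{0..}. (2 + exp (- ((2 * \<gamma> - 1) * t)) - exp (- t)) * E t)) at_top"
proof -
  have "2 * Yr 0 - Yr 1 + Yr (2 * \<gamma> - 1)
      = (LBINT t:{0..}. (2 + exp (- ((2 * \<gamma> - 1) * t)) - exp (- t)) * E t)"
  proof -
    have i: "set_integrable lborel {0..} (\<lambda>t. 2 * (exp (- (0 * t)) * E t))"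
      by (intro set_integrable_mult_right set_integrable_E) simp_all
    show ?thesis
      using set_integral_add(2)[OF set_integral_diff(1)[OF i set_integrable_E[of 1]]
          set_integrable_E[of "2 * \<gamma> - 1"]] set_integral_diff(2)[OF i set_integrable_E[of 1]] \<gamma>_ge
      unfolding Yr_def by (simp add: algebra_simps)
  qed
  moreover have "0 \<le> 2 * Yr 0 - Yr 1 + Yr (2 * \<gamma> - 1)"
    using Yr_antimono[of 0 1] Yr_nonneg[of 0] Yr_nonneg[of "2 * \<gamma> - 1"] by simp
  ultimately show ?thesis
    using tendsto_conserved_value by (simp add: conserved_value_eq)
qed

end

section \<open>The parking constant\<close>

context trapezium_parking
begin

text \<open>
  Lengths are measured in units of \<open>a\<close>, and adding \<open>2\<close> makes the delay equation homogeneous.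
\<close>

lemma parking_delay_equation_expected_total:
  "parking_delay_equation (c / a) (\<lambda>x. expected_total (a * x) + 2) (2 * a / c)"
proof -
  note pos = a_pos c_pos c_le_a a_le_2c
  have scale: "(\<integral>\<^sup>+u\<in>{0<..<a * q}. expected_total u \<partial>lborel) = ennreal a * (\<integral>\<^sup>+u\<in>{0<..<q}. expected_total (a * u) \<partial>lborel)" for q
    using pos by (subst nn_integral_real_affine[where c=a and t=0])
      (auto intro!: arg_cong2[where f=times] nn_integral_cong simp: indicator_def zero_less_mult_iff)
  show ?thesis
  proof
    show "1 / 2 \<le> c / a" "c / a \<le> 1" "0 \<le> 2 * a / c"
      using pos by (simp_all add: field_simps)
    show "(\<lambda>x. expected_total (a * x) + 2) \<in> borel_measurable borel" by measurable
    show "expected_total (a * u) + 2 = 2" if "0 < u" "u < c / a" for u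
      using that pos by (subst expected_total_less) (simp_all add: field_simps)
    show "expected_total (a * u) + 2 = 3" if "c / a \<le> u" "u < 1" for u
      using that pos by (subst expected_total_between) (simp_all add: field_simps)
    show "expected_total (a * u) + 2 \<le> ennreal (2 * a / c * u + 2)" if "0 \<le> u" for u
    proof -
      have "expected_total (a * u) + 2 \<le> ennreal (2 * (a * u) / c) + ennreal 2"
        by (intro add_mono expected_total_le) simp
      also have "\<dots> = ennreal (2 * a / c * u + 2)"
        using that pos by (subst ennreal_plus[symmetric]) simp_all
      finally show ?thesis .
    qed
    show "ennreal z * (expected_total (a * (z + 1)) + 2)
        = (\<integral>\<^sup>+u\<in>{0<..<z}. (expected_total (a * u) + 2) + (expected_total (a * (u + (1 - c / a))) + 2) \<partial>lborel)" if "0 < z" for z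
    proof -
      define \<delta> where "\<delta> = 1 - c / a"
      have \<delta>: "0 \<le> \<delta>" "a * \<delta> \<le> c" "a * (z + \<delta>) = a * (z + 1) - c"
        using pos by (simp_all add: \<delta>_def field_simps)
      have "ennreal a * (ennreal z * expected_total (a * (z + 1))) = ennreal (a * (z + 1) - a) * expected_total (a * (z + 1))"
      proof -
        have "a * (z + 1) - a = a * z" by (simp add: algebra_simps)
        then show ?thesis using pos that by (simp only: ennreal_mult less_imp_le mult.assoc)
      qed
      also have "\<dots> = 2 * ennreal (a * z) + (\<integral>\<^sup>+u\<in>{0<..<a * z}. expected_total u \<partial>lborel)
          + (\<integral>\<^sup>+u\<in>{0<..<a * (z + \<delta>)}. expected_total u \<partial>lborel)"
        using pos that by (subst expected_total_integral) (simp_all add: \<delta>(3), simp_all add: algebra_simps)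
      also have "\<dots> = ennreal a * (2 * ennreal z + (\<integral>\<^sup>+u\<in>{0<..<z}. expected_total (a * u) \<partial>lborel)
          + (\<integral>\<^sup>+u\<in>{0<..<z + \<delta>}. expected_total (a * u) \<partial>lborel))"
        unfolding scale using pos that by (subst ennreal_mult) (simp_all add: distrib_left ac_simps)
      finally have *: "ennreal z * expected_total (a * (z + 1)) = 2 * ennreal z + (\<integral>\<^sup>+u\<in>{0<..<z}. expected_total (a * u) \<partial>lborel)
          + (\<integral>\<^sup>+u\<in>{0<..<z + \<delta>}. expected_total (a * u) \<partial>lborel)"
        using pos by (subst (asm) ennreal_mult_cancel_left) auto
      have "(\<integral>\<^sup>+u\<in>{0<..<z + \<delta>}. expected_total (a * u) \<partial>lborel)
          = (\<integral>\<^sup>+u\<in>{0<..<\<delta>}. expected_total (a * u) \<partial>lborel) + (\<integral>\<^sup>+u\<in>{\<delta><..<z + \<delta>}. expected_total (a * u) \<partial>lborel)"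
        using \<delta> that by (intro nn_integral_interval_split) auto
      also have "(\<integral>\<^sup>+u\<in>{0<..<\<delta>}. expected_total (a * u) \<partial>lborel) = (\<integral>\<^sup>+u\<in>{0<..<\<delta>}. 0 \<partial>lborel)"
      proof (intro nn_integral_interval_cong expected_total_less)
        fix u assume "0 < u" "u < \<delta>"
        then have "a * u < a * \<delta>" using pos by simp
        then show "a * u < c" using \<delta>(2) by linarith
      qed
      also have "(\<integral>\<^sup>+u\<in>{\<delta><..<z + \<delta>}. expected_total (a * u) \<partial>lborel) = (\<integral>\<^sup>+u\<in>{0<..<z}. expected_total (a * (u + \<delta>)) \<partial>lborel)"
        using nn_integral_interval_shift[where g="\<lambda>u. expected_total (a * (u + \<delta>))" and p=\<delta> and q="z + \<delta>" and s=\<delta>]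
        by simp
      finally have shift: "(\<integral>\<^sup>+u\<in>{0<..<z + \<delta>}. expected_total (a * u) \<partial>lborel)
          = (\<integral>\<^sup>+u\<in>{0<..<z}. expected_total (a * (u + \<delta>)) \<partial>lborel)" by simp
      have "ennreal z * (expected_total (a * (z + 1)) + 2) = 2 * ennreal z + (\<integral>\<^sup>+u\<in>{0<..<z}. expected_total (a * u) \<partial>lborel)
          + (\<integral>\<^sup>+u\<in>{0<..<z}. expected_total (a * (u + \<delta>)) \<partial>lborel) + 2 * ennreal z"
        by (simp only: distrib_left[of "ennreal z" _ 2] * shift mult.commute[of "ennreal z" 2])
      also have "\<dots> = (\<integral>\<^sup>+u\<in>{0<..<z}. expected_total (a * u) \<partial>lborel) + 2 * ennreal (z - 0)
          + ((\<integral>\<^sup>+u\<in>{0<..<z}. expected_total (a * (u + \<delta>)) \<partial>lborel) + 2 * ennreal (z - 0))"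
        by (simp only: diff_zero add_ac)
      also have "\<dots> = (\<integral>\<^sup>+u\<in>{0<..<z}. (expected_total (a * u) + 2) + (expected_total (a * (u + \<delta>)) + 2) \<partial>lborel)"
      proof -
        have *: "(\<integral>\<^sup>+u\<in>{0<..<z}. g u + 2 \<partial>lborel) = (\<integral>\<^sup>+u\<in>{0<..<z}. g u \<partial>lborel) + 2 * ennreal (z - 0)"
          if "g \<in> borel_measurable borel" for g :: "real \<Rightarrow> ennreal"
          unfolding nn_integral_interval_const[symmetric]
          using that by (intro nn_integral_interval_add) auto
        have "(\<integral>\<^sup>+u\<in>{0<..<z}. (expected_total (a * u) + 2) + (expected_total (a * (u + \<delta>)) + 2) \<partial>lborel)
            = (\<integral>\<^sup>+u\<in>{0<..<z}. expected_total (a * u) + 2 \<partial>lborel) + (\<integral>\<^sup>+u\<in>{0<..<z}. expected_total (a * (u + \<delta>)) + 2 \<partial>lborel)"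
          by (rule nn_integral_interval_add) measurable
        then show ?thesis by (subst (asm) (1 2) *) simp_all
      qed
      finally show ?thesis unfolding \<delta>_def .
    qed
  qed
qed

lemma tendsto_eta:
  "((\<lambda>x. \<eta> x / x) \<longlongrightarrow> (LBINT t:{0..}. (2 + exp (- (t * (b / a))) - exp (- t)) *
      exp (LBINT s:{0..t}. (- 2 + exp (- (s * (1 + b / a) / 2)) + exp (- s)) / s)) / (2 * a)) at_top"
    (is "(_ \<longlongrightarrow> ?L / _) _")
proof -
  interpret parking_delay_equation "c / a" "\<lambda>x. expected_total (a * x) + 2" "2 * a / c"
    by (rule parking_delay_equation_expected_total)
  have ca: "c / a = (1 + b / a) / 2" "2 * ((1 + b / a) / 2) - 1 = b / a"
    using a_pos by (simp_all add: c_def field_simps)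
  have L: "(LBINT t:{0..}. (2 + exp (- ((2 * (c / a) - 1) * t)) - exp (- t)) * E t) = ?L"
    unfolding E_def rate_def unfolding ca
    by (simp only: mult.commute[of "b / a"] times_divide_eq_right)
  have lim: "((\<lambda>x. enn2real (expected_total (a * x) + 2) / x) \<longlongrightarrow> ?L) at_top"
    using tendsto_ratio unfolding L .
  have fin: "expected_total x < \<top>" for x
    using expected_total_le[of x] by (auto simp: less_top[symmetric] top_unique)
  have "((\<lambda>x. enn2real (expected_total (a * x) + 2) / x - 2 / x) \<longlongrightarrow> ?L - 0) at_top"
    by (intro tendsto_diff lim) real_asymp
  also have "(\<lambda>x. enn2real (expected_total (a * x) + 2) / x - 2 / x) = (\<lambda>x. enn2real (expected_total (a * x)) / x)"
    by (subst enn2real_plus) (auto simp: fin diff_divide_distrib[symmetric])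
  finally have "((\<lambda>x. enn2real (expected_total (a * x)) / x) \<longlongrightarrow> ?L) at_top" by simp
  moreover have "filterlim (\<lambda>x. x / a) at_top at_top"
    using a_pos by real_asymp
  ultimately have "((\<lambda>x. enn2real (expected_total (a * (x / a))) / (x / a)) \<longlongrightarrow> ?L) at_top"
    by (rule filterlim_compose)
  then have "((\<lambda>x. enn2real (expected_total (a * (x / a))) / (x / a) / (2 * a)) \<longlongrightarrow> ?L / (2 * a)) at_top"
    by (intro tendsto_intros) (use a_pos in auto)
  also have "(\<lambda>x. enn2real (expected_total (a * (x / a))) / (x / a) / (2 * a)) = (\<lambda>x. \<eta> x / x)"
    using a_pos by (auto simp: eta_eq_expected_total fun_eq_iff field_simps)
  finally show ?thesis .
qed

lemma parking_constant_eq: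
  "parking_constant = (1 + b / a) / 4 *
     (LBINT t:{0..}. (2 + exp (- (t * (b / a))) - exp (- t)) *
        exp (LBINT s:{0..t}. (- 2 + exp (- (s * (1 + b / a) / 2)) + exp (- s)) / s))"
  unfolding parking_constant_def density_def tendsto_Lim[OF trivial_limit_at_top_linorder tendsto_eta]
  using a_pos by (simp add: field_simps)

end

theorem corollary1p7:
  fixes a b :: real
  assumes "0 \<le> b" and "b \<le> a" and "0 < a"
  shows "trapezium_parking.parking_constant a b =
           (1 + b / a) / 4 *
             (LBINT t:{0..}. (2 + exp (- (t * (b / a))) - exp (- t)) *
                exp (LBINT s:{0..t}. (- 2 + exp (- (s * (1 + b / a) / 2)) + exp (- s)) / s))
       \<and> trapezium_parking.parking_constant a b = trapezium_parking.parking_constant 1 (b / a)"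
proof -
  have "trapezium_parking a b" "trapezium_parking 1 (b / a)"
    using assms by (simp_all add: trapezium_parking_def)
  then show ?thesis
    by (simp add: trapezium_parking.parking_constant_eq)
qed

end
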